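(* Let $U_+$ and $U_-$ be two unitary operators in a Hilbert space $\mathcal H$ such that $$\bigcap_{\lambda\in\mathbb C\setminus\mathbb T}\ker\left((U_+-\lambda I_{\mathcal H})^{-1}-(U_--\lambda I_{\mathcal H})^{-1}\right)=\{0\}$$ and $$\dim\operatorname{ran}\left((U_+-\lambda I_{\mathcal H})^{-1}-(U_--\lambda I_{\mathcal H})^{-1}\right)=n\quad\text{for all }\lambda\in\mathbb C\setminus\mathbb T,$$ and let $\Phi$ be the associated Carathéodory function. Assume that $n=1$ and that $\Phi$ is rational and satisfies $\Phi(\lambda)=-\overline{\Phi(1/\overline{\lambda})}$, so that its poles and zeros are on the unit circle. Let $f(\lambda)=\sum_{\ell=0}^\infty f_\ell\lambda^\ell$ be analytic in a disk $\{|\lambda|<R_0\}$ with $R_0>1$. Then $$\operatorname{Tr}\left\{f(U_-)-f(U_+)\right\}=\sum_{\lambda\text{ a pole or zero of }\Phi}f(\lambda).$$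
   Context: $\mathbb T$ is the unit circle in $\mathbb C$. Hilbert spaces are complex. $f(U_\pm)=\sum_{\ell=0}^\infty f_\ell U_\pm^\ell$. Associated Carathéodory function (case $n=1$): under the hypotheses on $U_\pm$, there exist a continuous linear operator $C:\mathcal H\to\mathbb C$ and a number $B\in\mathbb C$ with $|B|=1$ such that $$I_{\mathcal H}-U_+^*U_-=-C^*BC,\qquad B^{-1}+\overline{B^{-1}}=-CC^*.$$ Fix such a pair. The Carathéodory function associated to $(U_+,U_-)$ is $\Phi(\lambda)=B^{-1}+C(I_{\mathcal H}-\lambda U_+^* )^{-1}C^*$, $\lambda\in\mathbb C\setminus\mathbb T$. That $\Phi$ is rational and satisfies the symmetry means that the functions on both components $\{|\lambda|<1\}$ and $\{|\lambda|>1\}$ are restrictions of one and the same rational function, still denoted $\Phi$.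
   Formalization: The printed unsigned sum is false (on ℂ with U₊=1, U₋=−1, f=1 the trace is 0 but the sum is 2); here each f(λ) is weighted by the order of Φ at λ, positive at zeros and negative at poles. *)

theory Defs
  imports "HOL-Complex_Analysis.Complex_Analysis"
begin

text \<open>
  A complex Hilbert space. The real inner product of the superclass is the real part of
  the complex one, so norm and completeness are those induced by \<open>cinner\<close>, which is linear
  in its first argument.
\<close>

class chilbert_space = real_inner + complete_space +
  fixes scaleC :: "complex \<Rightarrow> 'a \<Rightarrow> 'a"  (infixr \<open>*\<^sub>C\<close> 75)
    and cinner :: "'a \<Rightarrow> 'a \<Rightarrow> complex"
  assumes scaleC_add_right: "a *\<^sub>C (x + y) = a *\<^sub>C x + a *\<^sub>C y"
    and scaleC_add_left: "(a + b) *\<^sub>C x = a *\<^sub>C x + b *\<^sub>C x"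
    and scaleC_scaleC: "a *\<^sub>C b *\<^sub>C x = (a * b) *\<^sub>C x"
    and scaleC_of_real: "complex_of_real r *\<^sub>C x = r *\<^sub>R x"
    and cinner_commute: "cinner x y = cnj (cinner y x)"
    and cinner_add_left: "cinner (x + y) z = cinner x z + cinner y z"
    and cinner_scaleC_left: "cinner (a *\<^sub>C x) y = a * cinner x y"
    and Re_cinner: "Re (cinner x y) = x \<bullet> y"

lemma scaleC_one: "1 *\<^sub>C (x :: 'a :: chilbert_space) = x"
  using scaleC_of_real[of 1 x] by simp

global_interpretation cvec: vector_space "scaleC :: complex \<Rightarrow> 'a \<Rightarrow> 'a :: chilbert_space"
  defines cdim = cvec.dim and cspan = cvec.span
  by standard (simp_all add: scaleC_add_right scaleC_add_left scaleC_scaleC scaleC_one)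

instantiation complex :: chilbert_space
begin

definition scaleC_complex :: "complex \<Rightarrow> complex \<Rightarrow> complex"
  where "scaleC_complex a x = a * x"

definition cinner_complex :: "complex \<Rightarrow> complex \<Rightarrow> complex"
  where "cinner_complex x y = x * cnj y"

instance
  by standard
    (auto simp: scaleC_complex_def cinner_complex_def algebra_simps scaleR_conv_of_real
      inner_complex_def)

end

definition bounded_clinear :: "('a :: chilbert_space \<Rightarrow> 'b :: chilbert_space) \<Rightarrow> bool"
  where "bounded_clinear T \<longleftrightarrow>
    Vector_Spaces.linear scaleC scaleC T \<and> continuous_on UNIV T"

definition cadjoint :: "('a :: chilbert_space \<Rightarrow> 'b :: chilbert_space) \<Rightarrow> 'b \<Rightarrow> 'a"
  where "cadjoint T = (SOME S. \<forall>x y. cinner (T x) y = cinner x (S y))"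

definition unitary_op :: "('a :: chilbert_space \<Rightarrow> 'a) \<Rightarrow> bool"
  where "unitary_op U \<longleftrightarrow> Vector_Spaces.linear scaleC scaleC U \<and> surj U \<and>
    (\<forall>x y. cinner (U x) (U y) = cinner x y)"

definition resolvent :: "('a :: chilbert_space \<Rightarrow> 'a) \<Rightarrow> complex \<Rightarrow> 'a \<Rightarrow> 'a"
  where "resolvent U z = inv (\<lambda>x. U x - z *\<^sub>C x)"

text \<open>
  The operator \<open>f(U)\<close> for \<open>f\<close> with Taylor coefficients \<open>a\<close>. The series is summed vector by
  vector; for unitary \<open>U\<close> and radius of convergence greater than one it also converges
  absolutely in operator norm, with the same sum.
\<close>

definition power_series_op ::
    "(nat \<Rightarrow> complex) \<Rightarrow> ('a :: chilbert_space \<Rightarrow> 'a) \<Rightarrow> 'a \<Rightarrow> 'a"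
  where "power_series_op a U x = (\<Sum>l. a l *\<^sub>C (U ^^ l) x)"

definition is_onb :: "'a :: chilbert_space set \<Rightarrow> bool"
  where "is_onb E \<longleftrightarrow> (\<forall>e\<in>E. norm e = 1) \<and>
    (\<forall>e\<in>E. \<forall>e'\<in>E. e \<noteq> e' \<longrightarrow> cinner e e' = 0) \<and> closure (cspan E) = UNIV"

definition hilbert_schmidt :: "('a :: chilbert_space \<Rightarrow> 'a) \<Rightarrow> bool"
  where "hilbert_schmidt T \<longleftrightarrow> bounded_clinear T \<and>
    (\<exists>E. is_onb E \<and> (\<lambda>e. (norm (T e))\<^sup>2) summable_on E)"

definition trace_class :: "('a :: chilbert_space \<Rightarrow> 'a) \<Rightarrow> bool"
  where "trace_class T \<longleftrightarrow> (\<exists>S R. hilbert_schmidt S \<and> hilbert_schmidt R \<and> T = S \<circ> R)"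

text \<open>Meaningful for trace class operators only, where the sum does not depend on the basis.\<close>

definition op_trace :: "('a :: chilbert_space \<Rightarrow> 'a) \<Rightarrow> complex"
  where "op_trace T = (THE t. \<forall>E. is_onb E \<longrightarrow> ((\<lambda>e. cinner (T e) e) has_sum t) E)"

text \<open>
  An operator on the one-dimensional space \<open>\<complex>\<close> is identified with its value at \<open>1\<close>; this is
  how \<open>C C\<^sup>*\<close> and \<open>C (I - z U\<^sub>+\<^sup>*)\<^sup>-\<^sup>1 C\<^sup>*\<close> become numbers.
\<close>

definition caratheodory_data ::
    "('a :: chilbert_space \<Rightarrow> 'a) \<Rightarrow> ('a \<Rightarrow> 'a) \<Rightarrow> ('a \<Rightarrow> complex) \<Rightarrow> complex \<Rightarrow> bool"
  where "caratheodory_data Up Um C B \<longleftrightarrow> bounded_clinear C \<and> cmod B = 1 \<and>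
    (\<forall>x. x - cadjoint Up (Um x) = - cadjoint C (B * C x)) \<and>
    inverse B + cnj (inverse B) = - C (cadjoint C 1)"

definition caratheodory_fun ::
    "('a :: chilbert_space \<Rightarrow> 'a) \<Rightarrow> ('a \<Rightarrow> complex) \<Rightarrow> complex \<Rightarrow> complex \<Rightarrow> complex"
  where "caratheodory_fun Up C B z =
    inverse B + C (inv (\<lambda>x. x - z *\<^sub>C cadjoint Up x) (cadjoint C 1))"

text \<open>
  Coprimality makes the value of a rational function correct at every point which is not a
  pole; at a pole the value is \<open>0\<close> by the convention for division.
\<close>

definition rational_function :: "(complex \<Rightarrow> complex) \<Rightarrow> bool"
  where "rational_function \<Phi> \<longleftrightarrow>
    (\<exists>p q :: complex poly. q \<noteq> 0 \<and> coprime p q \<and> \<Phi> = (\<lambda>z. poly p z / poly q z))"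

text \<open>
  The support of the divisor of a rational function. The multiplicity of a point of it is
  \<open>zorder\<close>, which is positive at zeros and negative at poles.
\<close>

definition poles_and_zeros :: "(complex \<Rightarrow> complex) \<Rightarrow> complex set"
  where "poles_and_zeros \<Phi> = {z. is_pole \<Phi> z \<or> \<Phi> z = 0}"

end

theory Submission
  imports Defs "HOL-Computational_Algebra.Fundamental_Theorem_Algebra"
begin

text \<open>
  By Riesz, \<open>C x = \<langle>x, c\<rangle>\<close>, so \<open>U\<^sub>-\<close> is the rank one perturbation \<open>x \<mapsto> U\<^sub>+ x + B \<langle>x, c\<rangle> U\<^sub>+ c\<close>.
  Let \<open>\<Phi> = p/q\<close>. Up to a polynomial, \<open>q \<Phi>\<close> is \<open>\<langle>(I - z U\<^sub>+\<^sup>*)\<^sup>-\<^sup>1 q(U\<^sub>+) c, c\<rangle>\<close>, which vanishes at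
  infinity. Hence it vanishes identically, and the kernel condition gives \<open>q(U\<^sub>+) c = 0\<close>. So \<open>c\<close>
  generates a finite-dimensional cyclic space, and this is the whole space.

  The function \<open>D(w) = B \<Phi>(1/w)\<close> is the perturbation determinant of \<open>I - w U\<^sub>-\<close> and \<open>I - w U\<^sub>+\<close>, so
  the generating function of the traces of \<open>U\<^sub>-\<^sup>l - U\<^sub>+\<^sup>l\<close> is \<open>- w D'(w) / D(w)\<close>. By Newton's
  identities it is also the generating function of the differences of the power sums of the zeros
  and of the poles of \<open>\<Phi>\<close>. Summing against the Taylor coefficients of \<open>f\<close> gives the trace formula.
\<close>

section \<open>Operators on complex Hilbert spaces\<close>

instance chilbert_space \<subseteq> banach ..

section \<open>Norm, Cauchy-Schwarz inequality and continuity for the complex inner product\<close>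

lemma cinner_scaleC_right: "cinner x (a *\<^sub>C y) = cnj a * cinner x y"
  by (metis cinner_commute cinner_scaleC_left complex_cnj_mult)

lemma cinner_add_right: "cinner x (y + z) = cinner x y + cinner x z"
  by (metis cinner_commute cinner_add_left complex_cnj_add)

lemma cinner_self: "cinner x x = of_real ((norm x)\<^sup>2)"
proof (rule complex_eqI)
  show "Im (cinner x x) = Im (of_real ((norm x)\<^sup>2))"
    using arg_cong[OF cinner_commute[of x x], of Im] by simp
qed (simp add: Re_cinner power2_norm_eq_inner)

lemma cinner_self_eq_0 [simp]: "cinner x x = 0 \<longleftrightarrow> x = 0"
  by (simp add: cinner_self)

lemma norm_scaleC: "norm (a *\<^sub>C x) = cmod a * norm x"
proof -
  have "complex_of_real ((norm (a *\<^sub>C x))\<^sup>2) = of_real ((cmod a * norm x)\<^sup>2)"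
    by (simp only: cinner_self[symmetric] cinner_scaleC_left cinner_scaleC_right)
       (simp add: cinner_self power_mult_distrib complex_norm_square mult.assoc del: of_real_power)
  then have "(norm (a *\<^sub>C x))\<^sup>2 = (cmod a * norm x)\<^sup>2"
    using of_real_eq_iff by blast
  then show ?thesis
    by (simp add: power2_eq_iff_nonneg)
qed

lemma cmod_cinner_le: "cmod (cinner x y) \<le> norm x * norm y"
proof -
  \<comment> \<open>The phase \<open>a\<close> rotates \<open>cinner x y\<close> onto the
    nonnegative real axis, so the real Cauchy-Schwarz inequality for \<open>a *\<^sub>C x\<close>
    and \<open>y\<close> gives the complex bound.\<close>
  obtain a where a: "cmod a = 1" "a * cinner x y = of_real (cmod (cinner x y))"
  proof (cases "cinner x y = 0")
    case False
    then show ?thesis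
      by (intro that[of "cnj (cinner x y) / of_real (cmod (cinner x y))"])
         (simp_all add: norm_divide mult.commute[of "cnj _"] power2_eq_square
           flip: complex_norm_square)
  next
    case True
    then show ?thesis by (intro that[of 1]) simp_all
  qed
  have "cmod (cinner x y) = (a *\<^sub>C x) \<bullet> y"
    using a by (simp add: Re_cinner[symmetric] cinner_scaleC_left)
  also have "\<dots> \<le> norm x * norm y"
    using norm_cauchy_schwarz[of "a *\<^sub>C x" y] a(1) by (simp add: norm_scaleC)
  finally show ?thesis .
qed

lemma cinner_scaleR_left: "cinner (r *\<^sub>R x) y = r *\<^sub>R cinner x y"
  by (metis scaleC_of_real cinner_scaleC_left scaleR_conv_of_real)

lemma cinner_scaleR_right: "cinner x (r *\<^sub>R y) = r *\<^sub>R cinner x y"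
  by (metis scaleC_of_real cinner_scaleC_right scaleR_conv_of_real complex_cnj_complex_of_real)

interpretation cinner: bounded_bilinear cinner
  by standard
    (auto simp: cinner_add_left cinner_add_right cinner_scaleR_left cinner_scaleR_right
      intro!: exI[of _ 1] cmod_cinner_le)

interpretation scaleC: bounded_bilinear "scaleC :: complex \<Rightarrow> 'a \<Rightarrow> 'a :: chilbert_space"
proof
  show "(r *\<^sub>R a) *\<^sub>C x = r *\<^sub>R a *\<^sub>C x" "a *\<^sub>C r *\<^sub>R x = r *\<^sub>R a *\<^sub>C x"
    for r a and x :: 'a
    unfolding scaleC_of_real[of r, symmetric, where 'a = 'a] scaleR_conv_of_real[of r a]
    by (simp_all add: scaleC_scaleC mult.commute)
qed (auto simp: scaleC_add_left scaleC_add_right norm_scaleC intro!: exI[of _ 1])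

lemma cinner_ext:
  assumes "\<And>x. cinner x y = cinner x z"
  shows "y = z"
  using assms[of "y - z"] cinner_self_eq_0[of "y - z"] by (simp add: cinner.diff_right)

section \<open>Complex linear maps, Riesz representation and adjoints\<close>

abbreviation clinear :: "('a :: chilbert_space \<Rightarrow> 'b :: chilbert_space) \<Rightarrow> bool"
  where "clinear \<equiv> Vector_Spaces.linear scaleC scaleC"

lemma clinearI:
  assumes "\<And>x y. T (x + y) = T x + T y" "\<And>a x. T (a *\<^sub>C x) = a *\<^sub>C T x"
  shows "clinear T"
  using assms
  by (simp add: Vector_Spaces.linear_iff vector_space_pair_def cvec.vector_space_axioms)

lemma clinearD:
  assumes "clinear T"
  shows clinear_add: "T (x + y) = T x + T y"
    and clinear_scaleC: "T (a *\<^sub>C x) = a *\<^sub>C T x"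
    and clinear_0: "T 0 = 0"
    and clinear_diff: "T (x - y) = T x - T y"
    and clinear_sum: "T (\<Sum>i\<in>A. g i) = (\<Sum>i\<in>A. T (g i))"
proof -
  interpret T: Vector_Spaces.linear scaleC scaleC T by fact
  show "T (x + y) = T x + T y" "T (a *\<^sub>C x) = a *\<^sub>C T x" "T 0 = 0" "T (x - y) = T x - T y"
    by (rule T.add T.scale T.zero T.diff)+
  show "T (\<Sum>i\<in>A. g i) = (\<Sum>i\<in>A. T (g i))" by (rule T.sum)
qed

text \<open>The representing vector is a multiple of the element of least norm in \<open>{x. C x = 1}\<close>.\<close>

lemma riesz_representation:
  fixes C :: "'a :: chilbert_space \<Rightarrow> complex"
  assumes "bounded_clinear C"
  obtains c where "\<And>x. C x = cinner x c"
proof (cases "\<forall>x. C x = 0")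
  case True
  then show ?thesis by (intro that[of 0]) (simp add: cinner.zero_right)
next
  case False
  have lin: "clinear C" and cont: "continuous_on UNIV C"
    using assms by (auto simp: bounded_clinear_def)
  have sc: "C (a *\<^sub>C x) = a * C x" for a x
    using clinear_scaleC[OF lin] by (simp add: scaleC_complex_def)
  define K where "K = {x. C x = 1}"
  define d where "d = (INF x\<in>K. norm x)"
  obtain x0 where "C x0 \<noteq> 0" using False by blast
  then have "inverse (C x0) *\<^sub>C x0 \<in> K" by (simp add: K_def sc)
  then have Kne: "K \<noteq> {}" by blast
  have bdd: "bdd_below (norm ` K)" by (rule bdd_belowI[of _ 0]) auto
  have d_le: "d \<le> norm x" if "x \<in> K" for x
    unfolding d_def by (rule cINF_lower[OF bdd that])
  have d0: "0 \<le> d" unfolding d_def by (rule cINF_greatest[OF Kne]) simp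
  have "\<exists>x\<in>K. norm x < d + inverse (Suc n)" for n
    using cInf_lessD[of "norm ` K" "d + inverse (Suc n)"] Kne by (auto simp: d_def)
  then obtain X where X: "X n \<in> K" "norm (X n) < d + inverse (Suc n)" for n
    by metis
  have lim_norm: "(\<lambda>n. norm (X n)) \<longlonglongrightarrow> d"
  proof (rule tendsto_sandwich[where f = "\<lambda>_. d"])
    show "(\<lambda>n. d + inverse (real (Suc n))) \<longlonglongrightarrow> d"
      using tendsto_add[OF tendsto_const LIMSEQ_inverse_real_of_nat, of d] by simp
  qed (use d_le X in \<open>auto simp: less_imp_le simp del: of_nat_Suc\<close>)
  \<comment> \<open>Parallelogram law: the midpoint of \<open>X m\<close> and \<open>X n\<close>
    lies in \<open>K\<close>, so its norm is at least \<open>d\<close>. This makes the minimising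
    sequence Cauchy.\<close>
  have diff: "(norm (X m - X n))\<^sup>2 \<le> 2 * (norm (X m))\<^sup>2 + 2 * (norm (X n))\<^sup>2 - 4 * d\<^sup>2" for m n
  proof -
    have "(1/2) *\<^sub>C (X m + X n) \<in> K"
      using X(1)[of m] X(1)[of n] by (simp add: K_def sc clinear_add[OF lin])
    from d_le[OF this] have "2 * d \<le> norm (X m + X n)"
      by (simp add: norm_scaleC norm_divide)
    then have "(2 * d)\<^sup>2 \<le> (norm (X m + X n))\<^sup>2"
      by (rule power_mono) (use d0 in simp)
    then show ?thesis
      by (simp add: power2_norm_eq_inner inner_add_left inner_add_right inner_diff_left
          inner_diff_right inner_commute power_mult_distrib)
  qed
  have "Cauchy X"
  proof (rule CauchyI)
    fix e :: real assume e: "0 < e"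
    have "(\<lambda>n. (norm (X n))\<^sup>2) \<longlonglongrightarrow> d\<^sup>2"
      by (intro tendsto_intros lim_norm)
    then have "\<forall>\<^sub>F n in sequentially. (norm (X n))\<^sup>2 < d\<^sup>2 + e\<^sup>2 / 4"
      by (rule order_tendstoD) (use e in simp)
    then obtain N where N: "\<And>n. n \<ge> N \<Longrightarrow> (norm (X n))\<^sup>2 < d\<^sup>2 + e\<^sup>2 / 4"
      by (auto simp: eventually_sequentially)
    show "\<exists>M. \<forall>m\<ge>M. \<forall>n\<ge>M. norm (X m - X n) < e"
    proof (intro exI allI impI)
      fix m n assume "m \<ge> N" "n \<ge> N"
      then have "(norm (X m - X n))\<^sup>2 < e\<^sup>2"
        using N[of m] N[of n] diff[of m n] by simp
      then show "norm (X m - X n) < e"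
        using e by (simp add: power_less_imp_less_base)
    qed
  qed
  then obtain x where lim: "X \<longlonglongrightarrow> x"
    using Cauchy_convergent_iff convergent_def by blast
  have "(\<lambda>n. C (X n)) \<longlonglongrightarrow> C x"
    using continuous_on_tendsto_compose[OF cont lim] by simp
  then have Cx: "C x = 1"
    using X(1) by (simp add: K_def LIMSEQ_const_iff)
  have nx: "norm x = d"
    using LIMSEQ_unique[OF tendsto_norm[OF lim] lim_norm] .
  have orth: "cinner y x = 0" if "C y = 0" for y
  proof (rule ccontr)
    assume nz: "cinner y x \<noteq> 0"
    then have "y \<noteq> 0" by (auto simp: cinner.zero_left)
    \<comment> \<open>\<open>t *\<^sub>C y\<close> is the projection of \<open>x\<close> onto
      \<open>y\<close>; subtracting it would shorten \<open>x\<close> without leaving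
      \<open>K\<close>.\<close>
    define t where "t = cnj (cinner y x) / of_real ((norm y)\<^sup>2)"
    have "x - t *\<^sub>C y \<in> K"
      using Cx that by (simp add: K_def sc clinear_diff[OF lin])
    from d_le[OF this] have "d\<^sup>2 \<le> (norm (x - t *\<^sub>C y))\<^sup>2"
      using d0 by (rule power_mono)
    also have "(norm (x - t *\<^sub>C y))\<^sup>2 = d\<^sup>2 - (cmod (cinner y x))\<^sup>2 / (norm y)\<^sup>2"
    proof -
      have 1: "t * cinner y x = of_real ((cmod (cinner y x))\<^sup>2 / (norm y)\<^sup>2)"
        unfolding t_def of_real_divide complex_norm_square by (simp add: mult.commute)
      have 2: "t * cnj t * of_real ((norm y)\<^sup>2) = of_real ((cmod (cinner y x))\<^sup>2 / (norm y)\<^sup>2)"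
        unfolding t_def of_real_divide complex_norm_square using \<open>y \<noteq> 0\<close>
        by (simp add: field_simps power2_eq_square)
      have "complex_of_real ((norm (x - t *\<^sub>C y))\<^sup>2) = of_real (d\<^sup>2) - t * cinner y x
          - cnj (t * cinner y x) + t * cnj t * of_real ((norm y)\<^sup>2)"
        unfolding cinner_self[symmetric] cinner.diff_left cinner.diff_right cinner_scaleC_left
          cinner_scaleC_right nx[symmetric]
        by (simp add: cinner_commute[of x y] algebra_simps)
      also have "\<dots> = of_real (d\<^sup>2 - (cmod (cinner y x))\<^sup>2 / (norm y)\<^sup>2)"
        unfolding 1 2 by simp
      finally show ?thesis by (simp only: of_real_eq_iff)
    qed
    finally have "(cmod (cinner y x))\<^sup>2 / (norm y)\<^sup>2 \<le> 0" by simp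
    moreover have "(cmod (cinner y x))\<^sup>2 / (norm y)\<^sup>2 > 0" using nz \<open>y \<noteq> 0\<close> by simp
    ultimately show False by linarith
  qed
  have "x \<noteq> 0" using Cx clinear_0[OF lin] by auto
  show ?thesis
  proof (rule that)
    fix v
    have "cinner (v - C v *\<^sub>C x) x = 0"
      by (rule orth) (simp add: clinear_diff[OF lin] sc Cx)
    then have "cinner v x = C v * of_real ((norm x)\<^sup>2)"
      by (simp add: cinner.diff_left cinner_scaleC_left cinner_self)
    then show "C v = cinner v (of_real (inverse ((norm x)\<^sup>2)) *\<^sub>C x)"
      using \<open>x \<noteq> 0\<close> by (simp add: cinner_scaleC_right)
  qed
qed

text \<open>The inner product is nondegenerate, so at most one map satisfies the adjoint identity,
  and exhibiting \<open>S\<close> settles the choice made in \<open>cadjoint\<close>.\<close>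

lemma cadjoint_eqI:
  assumes "\<And>x y. cinner (T x) y = cinner x (S y)"
  shows "cadjoint T = S"
proof -
  have *: "\<forall>x y. cinner (T x) y = cinner x (cadjoint T y)"
    unfolding cadjoint_def by (rule someI[where x = S]) (use assms in blast)
  show ?thesis
    by (rule ext, rule cinner_ext) (metis * assms)
qed

lemma cadjoint_functional:
  fixes C :: "'a :: chilbert_space \<Rightarrow> complex"
  assumes "\<And>x. C x = cinner x c"
  shows "cadjoint C w = w *\<^sub>C c"
  by (rule fun_cong[OF cadjoint_eqI])
     (simp add: assms cinner_scaleC_right cinner_complex_def mult.commute)

section \<open>Unitary operators and their resolvents off the circle\<close>

lemma unitary_bij:
  assumes "unitary_op U"
  shows "bij U"
proof -
  have "x = y" if "U x = U y" for x y
    using assms that clinear_diff[of U x y]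
    by (metis cinner_self_eq_0 cinner.zero_left eq_iff_diff_eq_0 unitary_op_def)
  then show ?thesis using assms by (auto simp: bij_def inj_def unitary_op_def)
qed

lemma unitary_clinear: "unitary_op U \<Longrightarrow> clinear U"
  by (simp add: unitary_op_def)

lemma cadjoint_unitary:
  assumes "unitary_op U"
  shows "cadjoint U = inv U"
proof (rule cadjoint_eqI)
  fix x y
  have "cinner (U x) y = cinner (U x) (U (inv U y))"
    using unitary_bij[OF assms] by (simp add: bij_is_surj surj_f_inv_f)
  then show "cinner (U x) y = cinner x (inv U y)"
    using assms by (simp add: unitary_op_def)
qed

lemma unitary_inv:
  assumes "unitary_op U"
  shows "unitary_op (inv U)"
proof -
  note bij = unitary_bij[OF assms]
  have UV: "U (inv U x) = x" for x using bij by (simp add: bij_is_surj surj_f_inv_f)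
  have inj: "U x = U y \<Longrightarrow> x = y" for x y using bij by (auto simp: bij_def inj_def)
  note lin = unitary_clinear[OF assms]
  have "clinear (inv U)"
    by (rule clinearI; rule inj) (simp_all add: UV clinear_add[OF lin] clinear_scaleC[OF lin])
  moreover have "surj (inv U)" using bij by (simp add: bij_imp_bij_inv bij_is_surj)
  moreover have "cinner (inv U x) (inv U y) = cinner x y" for x y
    using assms UV unfolding unitary_op_def by metis
  ultimately show ?thesis by (simp add: unitary_op_def)
qed

lemma norm_unitary: "unitary_op U \<Longrightarrow> norm (U x) = norm x"
  by (metis Re_cinner norm_eq_sqrt_inner unitary_op_def)

lemma norm_unitary_power: "unitary_op U \<Longrightarrow> norm ((U ^^ n) x) = norm x"
  by (induction n) (simp_all add: norm_unitary)

text \<open>Reverse triangle inequality for an isometry. It yields both the injectivity of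
  \<open>I - z U\<close> off the circle and the resolvent bound
  \<open>1 / \<bar>1 - cmod z\<bar>\<close>.\<close>

lemma norm_unitary_resolvent_ge:
  assumes "unitary_op U"
  shows "\<bar>1 - cmod z\<bar> * norm y \<le> norm (y - z *\<^sub>C U y)"
proof -
  have "\<bar>1 - cmod z\<bar> * norm y = \<bar>norm y - norm (z *\<^sub>C U y)\<bar>"
    using abs_mult[of "1 - cmod z" "norm y"]
    by (simp add: norm_scaleC norm_unitary[OF assms] left_diff_distrib)
  also have "\<dots> \<le> norm (y - z *\<^sub>C U y)" by (rule norm_triangle_ineq3)
  finally show ?thesis .
qed

lemma unitary_resolvent_inj:
  assumes "unitary_op U" "cmod z \<noteq> 1" "x - z *\<^sub>C U x = y - z *\<^sub>C U y"
  shows "x = y"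
proof -
  have "(x - y) - z *\<^sub>C U (x - y) = 0"
    using assms(3) by (simp add: clinear_diff[OF unitary_clinear[OF assms(1)]]
        scaleC.diff_right algebra_simps)
  then have "\<bar>1 - cmod z\<bar> * norm (x - y) \<le> 0"
    using norm_unitary_resolvent_ge[OF assms(1), of z "x - y"] by simp
  then show ?thesis using assms(2) by (simp add: mult_le_0_iff)
qed

text \<open>Inside the disk the solution is the fixed point of a contraction. Outside, applying
  \<open>inv U\<close> and dividing by \<open>- z\<close> turns the equation into one for the
  unitary \<open>inv U\<close> at \<open>inverse z\<close>, which lies inside.\<close>

lemma unitary_resolvent_surj:
  assumes "unitary_op U" "cmod z \<noteq> 1"
  obtains y where "y - z *\<^sub>C U y = x"
proof -
  have small: "\<exists>y. y - w *\<^sub>C T y = v" if T: "unitary_op T" and w: "cmod w < 1" for T w and v :: 'a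
  proof -
    have "\<exists>!y. v + w *\<^sub>C T y = y"
    proof (rule banach_fix_type[of "cmod w"])
      show "\<forall>x y. dist (v + w *\<^sub>C T x) (v + w *\<^sub>C T y) \<le> cmod w * dist x y"
      proof (intro allI)
        fix x y
        have "v + w *\<^sub>C T x - (v + w *\<^sub>C T y) = w *\<^sub>C T (x - y)"
          by (simp add: scaleC.diff_right clinear_diff[OF unitary_clinear[OF T]])
        then show "dist (v + w *\<^sub>C T x) (v + w *\<^sub>C T y) \<le> cmod w * dist x y"
          by (simp add: dist_norm norm_scaleC norm_unitary[OF T])
      qed
    qed (use w in simp_all)
    then show ?thesis by (metis add_diff_cancel_right')
  qed
  show ?thesis
  proof (cases "cmod z < 1")
    case True
    then show ?thesis using small[OF assms(1) True, of x] that by blast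
  next
    case False
    then have z: "cmod z > 1" "z \<noteq> 0" using assms(2) by auto
    let ?W = "inv U"
    have "cmod (inverse z) < 1" using z by (simp add: norm_inverse inverse_less_1_iff)
    from small[OF unitary_inv[OF assms(1)] this, of "- inverse z *\<^sub>C ?W x"]
    obtain y where y: "y - inverse z *\<^sub>C ?W y = - inverse z *\<^sub>C ?W x" by blast
    have UW: "U (?W v) = v" for v
      using unitary_bij[OF assms(1)] by (simp add: bij_is_surj surj_f_inv_f)
    have "U y - inverse z *\<^sub>C y = - inverse z *\<^sub>C x"
      using arg_cong[OF y, of U] unitary_clinear[OF assms(1)]
      by (simp only: clinear_diff clinear_scaleC UW)
    from arg_cong[OF this, of "\<lambda>v. (- z) *\<^sub>C v"] have "y - z *\<^sub>C U y = x"
      using z(2) by (simp add: scaleC.diff_right scaleC_scaleC scaleC_one scaleC.minus_left)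
    then show ?thesis by (rule that)
  qed
qed

lemma inv_unitary_resolvent:
  assumes "unitary_op U" "cmod z \<noteq> 1"
  shows "inv (\<lambda>x. x - z *\<^sub>C U x) (y - z *\<^sub>C U y) = y"
  by (rule inv_f_f) (auto simp: inj_def intro: unitary_resolvent_inj[OF assms])

section \<open>Finite orthonormal bases and traces\<close>

definition orthonormal :: "'a :: chilbert_space set \<Rightarrow> bool"
  where "orthonormal E \<longleftrightarrow> (\<forall>e\<in>E. norm e = 1) \<and> (\<forall>e\<in>E. \<forall>e'\<in>E. e \<noteq> e' \<longrightarrow> cinner e e' = 0)"

lemma is_onb_iff: "is_onb E \<longleftrightarrow> orthonormal E \<and> closure (cspan E) = UNIV"
  by (simp add: is_onb_def orthonormal_def)

lemma orthonormal_subset: "orthonormal E \<Longrightarrow> G \<subseteq> E \<Longrightarrow> orthonormal G"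
  by (auto simp: orthonormal_def)

lemma orthonormal_cinner:
  "orthonormal E \<Longrightarrow> e \<in> E \<Longrightarrow> e' \<in> E \<Longrightarrow> cinner e e' = (if e = e' then 1 else 0)"
  by (auto simp: orthonormal_def cinner_self)

lemma orthonormal_coeff:
  assumes "finite E" "orthonormal E" "e \<in> E"
  shows "cinner (\<Sum>d\<in>E. a d *\<^sub>C d) e = a e"
proof -
  have "cinner (\<Sum>d\<in>E. a d *\<^sub>C d) e = (\<Sum>d\<in>E. if d = e then a d else 0)"
    unfolding cinner.sum_left cinner_scaleC_left
    by (rule sum.cong) (simp_all add: orthonormal_cinner[OF assms(2) _ assms(3)])
  then show ?thesis using assms by (simp add: sum.delta')
qed

lemma orthonormal_residual:
  assumes "finite E" "orthonormal E" "e \<in> E"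
  shows "cinner (x - (\<Sum>d\<in>E. cinner x d *\<^sub>C d)) e = 0"
  using orthonormal_coeff[OF assms, of "cinner x"] by (simp add: cinner.diff_left)

text \<open>Phrased through orthogonal complements instead of spans, because
  \<open>finite_onbI\<close> tests completeness in that form.\<close>

lemma gram_schmidt:
  assumes "finite S"
  shows "\<exists>E. finite E \<and> orthonormal E \<and>
    (\<forall>y. (\<forall>e\<in>E. cinner y e = 0) \<longrightarrow> (\<forall>s\<in>S. cinner y s = 0))"
  using assms
proof induction
  case empty
  show ?case by (rule exI[of _ "{}"]) (simp add: orthonormal_def)
next
  case (insert s S)
  then obtain E where E: "finite E" "orthonormal E"
    and S: "\<And>y. (\<forall>e\<in>E. cinner y e = 0) \<Longrightarrow> \<forall>s\<in>S. cinner y s = 0" by blast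
  define r where "r = s - (\<Sum>e\<in>E. cinner s e *\<^sub>C e)"
  have r: "cinner r e = 0" "cinner e r = 0" if "e \<in> E" for e
    using orthonormal_residual[OF E that, of s] cinner_commute[of e r] by (simp_all add: r_def)
  have s: "cinner y s = 0" if "\<forall>e\<in>E. cinner y e = 0" "cinner y r = 0" for y
  proof -
    have "s = r + (\<Sum>e\<in>E. cinner s e *\<^sub>C e)" by (simp add: r_def)
    then have "cinner y s = cinner y r + (\<Sum>e\<in>E. cnj (cinner s e) * cinner y e)"
      by (metis (no_types, lifting) cinner_add_right cinner.sum_right cinner_scaleC_right sum.cong)
    then show ?thesis using that by simp
  qed
  show ?case
  proof (cases "r = 0")
    case True
    then show ?thesis using E S s by (intro exI[of _ E]) (auto simp: cinner.zero_right)
  next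
    case False
    let ?u = "inverse (norm r) *\<^sub>R r"
    have "orthonormal (insert ?u E)"
      using E(2) False r by (auto simp: orthonormal_def cinner_scaleR_left cinner_scaleR_right)
    moreover have "cinner y r = 0" if "cinner y ?u = 0" for y
      using that False by (simp add: cinner_scaleR_right)
    ultimately show ?thesis using E S s
      by (intro exI[of _ "insert ?u E"]) auto
  qed
qed

text \<open>The vectors orthogonal to \<open>y\<close> form a closed subspace. It contains
  \<open>E\<close>, hence everything, hence \<open>y\<close> itself.\<close>

lemma onb_complete:
  assumes "is_onb E" "\<And>e. e \<in> E \<Longrightarrow> cinner y e = 0"
  shows "y = 0"
proof -
  have "x \<in> {x. cinner y x = 0}" if "x \<in> cspan E" for x
    using that
    by (rule cvec.span_induct[where P = "\<lambda>x. x \<in> {x. cinner y x = 0}"])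
       (auto simp: assms(2) cvec.subspace_def cinner_add_right cinner_scaleC_right cinner.zero_right)
  moreover have "closed {x. cinner y x = 0}"
    by (intro closed_Collect_eq cinner.continuous_on continuous_intros)
  ultimately have "closure (cspan E) \<subseteq> {x. cinner y x = 0}"
    by (intro closure_minimal) auto
  then have "UNIV \<subseteq> {x. cinner y x = 0}" using assms(1) by (simp add: is_onb_iff)
  then have "cinner y y = 0" by blast
  then show ?thesis by simp
qed

lemma onb_expansion:
  assumes "finite E" "is_onb E"
  shows "(\<Sum>e\<in>E. cinner x e *\<^sub>C e) = x"
proof -
  have "x - (\<Sum>e\<in>E. cinner x e *\<^sub>C e) = 0"
    using assms by (intro onb_complete[OF assms(2)] orthonormal_residual) (auto simp: is_onb_iff)
  then show ?thesis by simp
qed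

lemma finite_onbI:
  assumes "finite E" "orthonormal E" "\<And>y. (\<And>e. e \<in> E \<Longrightarrow> cinner y e = 0) \<Longrightarrow> y = 0"
  shows "is_onb E"
proof -
  have "x \<in> cspan E" for x
  proof -
    have "x - (\<Sum>e\<in>E. cinner x e *\<^sub>C e) = 0"
      by (intro assms(3) orthonormal_residual assms(1,2))
    moreover have "(\<Sum>e\<in>E. cinner x e *\<^sub>C e) \<in> cspan E"
      by (intro cvec.span_sum cvec.span_scale cvec.span_base)
    ultimately show ?thesis by simp
  qed
  then have "cspan E = UNIV" by blast
  then show ?thesis using assms(2) by (simp add: is_onb_iff)
qed

lemma onb_parseval:
  assumes "finite E" "is_onb E"
  shows "(\<Sum>e\<in>E. cinner x e * cinner e y) = cinner x y"
proof -
  have "cinner x y = cinner (\<Sum>e\<in>E. cinner x e *\<^sub>C e) y"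
    by (simp add: onb_expansion[OF assms])
  then show ?thesis by (simp add: cinner.sum_left cinner_scaleC_left)
qed

lemma bessel:
  assumes "finite E" "orthonormal E"
  shows "(\<Sum>e\<in>E. (cmod (cinner x e))\<^sup>2) \<le> (norm x)\<^sup>2"
proof -
  define p where "p = (\<Sum>e\<in>E. cinner x e *\<^sub>C e)"
  have xp: "cinner x p = of_real (\<Sum>e\<in>E. (cmod (cinner x e))\<^sup>2)"
    by (simp add: p_def cinner.sum_right cinner_scaleC_right complex_norm_square mult.commute
        del: of_real_power)
  have "cinner (x - p) p = (\<Sum>e\<in>E. cnj (cinner x e) * cinner (x - p) e)"
    by (subst (2) p_def) (simp add: cinner.sum_right cinner_scaleC_right)
  also have "\<dots> = 0"
    using orthonormal_residual[OF assms, of _ x] by (simp add: p_def)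
  finally have pp: "cinner p p = cinner x p" by (simp add: cinner.diff_left)
  have "(norm (x - p))\<^sup>2 = (norm x)\<^sup>2 - 2 * (x \<bullet> p) + p \<bullet> p"
    by (simp add: power2_norm_eq_inner inner_diff_left inner_diff_right inner_commute)
  also have "\<dots> = (norm x)\<^sup>2 - (\<Sum>e\<in>E. (cmod (cinner x e))\<^sup>2)"
    unfolding Re_cinner[symmetric] pp xp by simp
  finally show ?thesis by (metis diff_ge_0_iff_ge zero_le_power2)
qed

text \<open>Double counting of \<open>(cmod (cinner f g))\<^sup>2\<close> over \<open>F\<close> and
  a finite part \<open>G\<close> of \<open>E\<close>: Parseval along \<open>F\<close> gives
  \<open>card G\<close>, Bessel along \<open>G\<close> gives at most \<open>card F\<close>. Thus
  \<open>op_trace\<close> ranges over finite bases only.\<close>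

lemma finite_orthonormal:
  fixes E F :: "'a :: chilbert_space set"
  assumes F: "finite F" "is_onb F" and E: "orthonormal E"
  shows "finite E"
proof -
  have "card G \<le> card F" if G: "G \<subseteq> E" "finite G" for G
  proof -
    have oG: "orthonormal G" using E G(1) by (rule orthonormal_subset)
    have "real (card G) = (\<Sum>g\<in>G. \<Sum>f\<in>F. (cmod (cinner f g))\<^sup>2)"
    proof -
      have "(\<Sum>f\<in>F. (cmod (cinner f g))\<^sup>2) = 1" if "g \<in> G" for g
      proof -
        have "complex_of_real (\<Sum>f\<in>F. (cmod (cinner f g))\<^sup>2) = (\<Sum>f\<in>F. cinner g f * cinner f g)"
          by (simp add: complex_norm_square cinner_commute[of g] mult.commute del: of_real_power)
        also have "\<dots> = of_real 1"
          using oG that by (simp add: onb_parseval[OF F] orthonormal_cinner)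
        finally show ?thesis using of_real_eq_iff by blast
      qed
      then show ?thesis by simp
    qed
    also have "\<dots> = (\<Sum>f\<in>F. \<Sum>g\<in>G. (cmod (cinner f g))\<^sup>2)" by (rule sum.swap)
    also have "\<dots> \<le> (\<Sum>f\<in>F. (norm f)\<^sup>2)" by (intro sum_mono bessel G oG)
    also have "\<dots> = card F" using F(2) by (simp add: is_onb_def)
    finally show ?thesis by simp
  qed
  then show ?thesis using finite_if_finite_subsets_card_bdd[of E "card F"] by blast
qed

text \<open>Parseval along \<open>F\<close> introduces the second basis; after swapping the sums,
  the expansion along \<open>E\<close> removes the first.\<close>

lemma trace_onb_independent:
  assumes "finite E" "is_onb E" "finite F" "is_onb F" "clinear T"
  shows "(\<Sum>e\<in>E. cinner (T e) e) = (\<Sum>f\<in>F. cinner (T f) f)"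
proof -
  have "(\<Sum>e\<in>E. cinner (T e) e) = (\<Sum>e\<in>E. \<Sum>f\<in>F. cinner (T e) f * cinner f e)"
    by (simp add: onb_parseval assms)
  also have "\<dots> = (\<Sum>f\<in>F. \<Sum>e\<in>E. cinner (cinner f e *\<^sub>C T e) f)"
    by (subst sum.swap) (simp add: cinner_scaleC_left mult.commute)
  also have "\<dots> = (\<Sum>f\<in>F. cinner (T (\<Sum>e\<in>E. cinner f e *\<^sub>C e)) f)"
    by (simp add: clinear_sum[OF assms(5)] clinear_scaleC[OF assms(5)] cinner.sum_left)
  also have "\<dots> = (\<Sum>f\<in>F. cinner (T f) f)"
    by (simp add: onb_expansion assms)
  finally show ?thesis .
qed

lemma op_trace_finite:
  assumes "finite F" "is_onb F" "clinear T"
  shows "op_trace T = (\<Sum>f\<in>F. cinner (T f) f)"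
  unfolding op_trace_def
proof (rule the_equality)
  show "\<forall>E. is_onb E \<longrightarrow> ((\<lambda>e. cinner (T e) e) has_sum (\<Sum>f\<in>F. cinner (T f) f)) E"
  proof (intro allI impI)
    fix E :: "'a set" assume E: "is_onb E"
    then have fin: "finite E" using finite_orthonormal assms by (auto simp: is_onb_iff)
    show "((\<lambda>e. cinner (T e) e) has_sum (\<Sum>f\<in>F. cinner (T f) f)) E"
      using has_sum_finite[OF fin] trace_onb_independent[OF fin E assms] by metis
  qed
  fix t assume "\<forall>E. is_onb E \<longrightarrow> ((\<lambda>e. cinner (T e) e) has_sum t) E"
  then have "((\<lambda>e. cinner (T e) e) has_sum t) F" using assms(2) by blast
  then show "t = (\<Sum>f\<in>F. cinner (T f) f)"
    using has_sum_finite[OF assms(1)] has_sum_unique by blast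
qed

text \<open>With a finite basis every linear operator is continuous and Hilbert-Schmidt, so
  \<open>T = T \<circ> id\<close> is an admissible factorization.\<close>

lemma trace_class_finite:
  fixes T :: "'a :: chilbert_space \<Rightarrow> 'a" and F :: "'a set"
  assumes "finite F" "is_onb F" "clinear T"
  shows "trace_class T"
proof -
  have hs: "hilbert_schmidt S" if S: "clinear S" for S :: "'a \<Rightarrow> 'a"
  proof -
    have "(\<Sum>f\<in>F. cinner x f *\<^sub>C S f) = S x" for x
    proof -
      have "S x = S (\<Sum>f\<in>F. cinner x f *\<^sub>C f)" by (simp add: onb_expansion[OF assms(1,2)])
      then show ?thesis
        by (simp add: clinear_sum[OF S] clinear_scaleC[OF S])
    qed
    moreover have "continuous_on UNIV (\<lambda>x. \<Sum>f\<in>F. cinner x f *\<^sub>C S f)"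
      by (intro continuous_intros scaleC.continuous_on cinner.continuous_on)
    ultimately have "continuous_on UNIV S" by simp
    then have "bounded_clinear S" using S by (simp add: bounded_clinear_def)
    then show ?thesis using assms(1,2) summable_on_finite by (auto simp: hilbert_schmidt_def)
  qed
  have "clinear (id :: 'a \<Rightarrow> 'a)" by (rule clinearI) simp_all
  then show ?thesis unfolding trace_class_def
    using hs[OF assms(3)] hs by (metis comp_id)
qed

section \<open>Rational functions and power sums of their zeros and poles\<close>

text \<open>By the geometric series this is the sum of \<open>1 / (1 - x X)\<close> over
  \<open>x\<close> in \<open>A\<close>.\<close>

definition power_sum_fps :: "complex multiset \<Rightarrow> complex fps"
  where "power_sum_fps A = Abs_fps (\<lambda>l. \<Sum>x\<in>#A. x ^ l)"

lemma power_sum_fps_add_mset: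
  "(1 - fps_const x * fps_X) * power_sum_fps (add_mset x A)
    = 1 + (1 - fps_const x * fps_X) * power_sum_fps A"
proof -
  have "power_sum_fps (add_mset x A) = Abs_fps (\<lambda>l. x ^ l) + power_sum_fps A"
    by (simp add: power_sum_fps_def fps_eq_iff)
  moreover have "(1 - fps_const x * fps_X) * Abs_fps (\<lambda>l. x ^ l) = 1"
    by (rule fps_ext) (simp add: left_diff_distrib mult.assoc fps_X_def[symmetric] power_eq_if)
  ultimately show ?thesis by (simp add: distrib_left)
qed

text \<open>Newton's identities; \<open>R A\<close> is the reversal of the monic polynomial with roots \<open>A\<close>.\<close>

lemma power_sum_fps_prod_mset:
  defines "R \<equiv> \<lambda>A. \<Prod>x\<in>#A. 1 - fps_const x * fps_X"
  shows "R A * power_sum_fps A = of_nat (size A) * R A - fps_X * fps_deriv (R A)"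
proof (induction A)
  case empty
  then show ?case by (simp add: R_def power_sum_fps_def fps_eq_iff)
next
  case (add x A)
  let ?L = "1 - fps_const x * fps_X"
  have R: "R (add_mset x A) = ?L * R A" by (simp add: R_def)
  have "R (add_mset x A) * power_sum_fps (add_mset x A)
      = R A * (?L * power_sum_fps (add_mset x A))"
    unfolding R by (simp add: mult_ac)
  also have "\<dots> = R A + ?L * (R A * power_sum_fps A)"
    unfolding power_sum_fps_add_mset by (simp add: algebra_simps)
  also have "\<dots> = of_nat (size (add_mset x A)) * R (add_mset x A)
      - fps_X * fps_deriv (R (add_mset x A))"
    unfolding add.IH R by (simp add: algebra_simps)
  finally show ?case .
qed

text \<open>Reversal is multiplicative and turns each linear factor \<open>X - x\<close> into
  \<open>1 - x X\<close>.\<close>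

lemma fps_of_poly_reflect_poly:
  "fps_of_poly (reflect_poly p)
    = fps_const (lead_coeff p) * (\<Prod>x\<in>#proots p. 1 - fps_const x * fps_X)"
  for p :: "complex poly"
proof -
  have *: "fps_of_poly (reflect_poly (\<Prod>x\<in>#A. [:-x, 1:])) = (\<Prod>x\<in>#A. 1 - fps_const x * fps_X)"
    for A :: "complex multiset"
  proof (induction A)
    case (add x A)
    have "fps_of_poly (reflect_poly [:- x, 1:]) = 1 - fps_const x * fps_X"
      by (rule fps_ext) (auto simp: coeff_reflect_poly coeff_pCons fps_X_def split: nat.splits)
    with add show ?case
      by (simp only: image_mset_add_mset prod_mset.add_mset reflect_poly_mult fps_of_poly_mult)
  qed simp
  show ?thesis
    by (subst complex_poly_decompose_multiset[symmetric])
       (simp only: reflect_poly_smult fps_of_poly_smult *)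
qed

lemma newton_reflect_poly:
  fixes p :: "complex poly"
  defines "P \<equiv> fps_of_poly (reflect_poly p)"
  shows "P * power_sum_fps (proots p) = of_nat (degree p) * P - fps_X * fps_deriv P"
proof -
  define R where "R = (\<Prod>x\<in>#proots p. 1 - fps_const x * fps_X)"
  have P: "P = fps_const (lead_coeff p) * R"
    by (simp add: P_def R_def fps_of_poly_reflect_poly)
  have "P * power_sum_fps (proots p) = fps_const (lead_coeff p) * (R * power_sum_fps (proots p))"
    by (simp add: P mult.assoc)
  also have "R * power_sum_fps (proots p) = of_nat (degree p) * R - fps_X * fps_deriv R"
    using power_sum_fps_prod_mset[of "proots p"] by (simp add: R_def size_proots_complex)
  finally show ?thesis by (simp add: P algebra_simps)
qed

text \<open>\<open>T\<close> is \<open>- X D' / D\<close>, and \<open>D = b P / Q\<close> splits the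
  logarithmic derivative into those of \<open>P\<close> and \<open>Q\<close>. Newton's identities
  evaluate both; the constants they contribute are the degrees, which cancel. The computation is
  carried out with denominators cleared.\<close>

lemma log_derivative_fps_quotient:
  fixes p q :: "complex poly" and D T :: "complex fps"
  assumes p: "p \<noteq> 0" and q: "q \<noteq> 0" and deg: "degree p = degree q" and b: "b \<noteq> 0"
    and DQ: "D * fps_of_poly (reflect_poly q) = fps_const b * fps_of_poly (reflect_poly p)"
    and DT: "D * T = - (fps_X * fps_deriv D)"
  shows "T = power_sum_fps (proots p) - power_sum_fps (proots q)"
proof -
  define P Q where "P = fps_of_poly (reflect_poly p)" and "Q = fps_of_poly (reflect_poly q)"
  define S where "S = power_sum_fps (proots p) - power_sum_fps (proots q)"
  have nz: "P \<noteq> 0" "Q \<noteq> 0" using p q by (simp_all add: P_def Q_def)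
  have DQ': "D * Q = fps_const b * P" using DQ by (simp add: P_def Q_def)
  with nz b have "D \<noteq> 0" by auto
  have P': "fps_deriv D * Q + D * fps_deriv Q = fps_const b * fps_deriv P"
    using arg_cong[OF DQ', of fps_deriv] by (simp add: algebra_simps)
  have NP: "P * power_sum_fps (proots p) = of_nat (degree q) * P - fps_X * fps_deriv P"
    using newton_reflect_poly[of p] by (simp add: P_def deg)
  have NQ: "Q * power_sum_fps (proots q) = of_nat (degree q) * Q - fps_X * fps_deriv Q"
    using newton_reflect_poly[of q] by (simp add: Q_def)
  have "fps_const b * (D * Q * P * T) = (D * T) * Q * (fps_const b * P)"
    by (simp add: mult_ac)
  also have "\<dots> = - (fps_X * fps_deriv D * D * Q * Q)"
    unfolding DT DQ'[symmetric] by (simp add: mult_ac)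
  also have "\<dots> = - fps_X * (D * Q * (fps_deriv D * Q + D * fps_deriv Q)
      - D * (fps_const b * P) * fps_deriv Q)"
    unfolding DQ'[symmetric] by (simp add: algebra_simps)
  also have "\<dots> = fps_const b * (D * Q * (of_nat (degree q) * P - fps_X * fps_deriv P)
      - D * P * (of_nat (degree q) * Q - fps_X * fps_deriv Q))"
    unfolding P' by (simp add: algebra_simps)
  also have "\<dots> = fps_const b * (D * Q * P * S)"
    unfolding NP[symmetric] NQ[symmetric] S_def by (simp add: algebra_simps)
  finally show ?thesis
    using \<open>D \<noteq> 0\<close> nz b by (simp add: S_def)
qed

text \<open>Splitting off the full powers of \<open>z - a\<close> leaves a quotient of cofactors
  that is holomorphic and nonzero at \<open>a\<close>, as the characterization of
  \<open>zorder\<close> demands.\<close>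

lemma zorder_poly_quotient:
  fixes p q :: "complex poly"
  assumes "p \<noteq> 0" "q \<noteq> 0"
  shows "zorder (\<lambda>z. poly p z / poly q z) a = int (order a p) - int (order a q)"
proof -
  obtain p' where p': "p = [:- a, 1:] ^ order a p * p'" "\<not> [:- a, 1:] dvd p'"
    using order_decomp[OF assms(1)] by blast
  obtain q' where q': "q = [:- a, 1:] ^ order a q * q'" "\<not> [:- a, 1:] dvd q'"
    using order_decomp[OF assms(2)] by blast
  have nz: "poly p' a \<noteq> 0" "poly q' a \<noteq> 0" using p'(2) q'(2) by (simp_all add: poly_eq_0_iff_dvd)
  show ?thesis
  proof (rule zorder_eqI)
    show "open {w. poly q' w \<noteq> 0}"
      by (intro open_Collect_neq continuous_intros)
    show "(\<lambda>w. poly p' w / poly q' w) holomorphic_on {w. poly q' w \<noteq> 0}"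
      by (intro holomorphic_intros) auto
    show "poly p w / poly q w = poly p' w / poly q' w * (w - a) powi (int (order a p) - int (order a q))"
      if "w \<noteq> a" for w
    proof -
      have "poly p w = (w - a) ^ order a p * poly p' w" "poly q w = (w - a) ^ order a q * poly q' w"
        by (subst p'(1) q'(1); simp)+
      then show ?thesis using that by (simp add: power_int_diff mult.commute)
    qed
  qed (use nz in auto)
qed

lemma is_pole_poly_quotient_imp_root:
  fixes p q :: "complex poly"
  assumes "is_pole (\<lambda>z. poly p z / poly q z) a"
  shows "poly q a = 0"
proof (rule ccontr)
  assume "poly q a \<noteq> 0"
  then have "((\<lambda>z. poly p z / poly q z) \<longlongrightarrow> poly p a / poly q a) (at a)"
    by (intro tendsto_intros)
  then show False
    using assms not_tendsto_and_filterlim_at_infinity[of "at a"] by (auto simp: is_pole_def)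
qed

section \<open>Rank one perturbations of unitary operators\<close>

lemma clinear_funpow:
  fixes T :: "'a :: chilbert_space \<Rightarrow> 'a"
  assumes "clinear T"
  shows "clinear (T ^^ n)"
proof (rule clinearI)
  show "(T ^^ n) (x + y) = (T ^^ n) x + (T ^^ n) y" for x y
    by (induction n) (simp_all add: clinear_add[OF assms])
  show "(T ^^ n) (a *\<^sub>C x) = a *\<^sub>C (T ^^ n) x" for a x
    by (induction n) (simp_all add: clinear_scaleC[OF assms])
qed

text \<open>Allowing any finite \<open>S\<close> that contains the roots lets the sums for two
  polynomials run over one index set.\<close>

lemma sum_mset_proots:
  fixes g :: "complex \<Rightarrow> complex"
  assumes "p \<noteq> 0" "finite S" "{z. poly p z = 0} \<subseteq> S"
  shows "(\<Sum>z\<in>#proots p. g z) = (\<Sum>z\<in>S. of_nat (order z p) * g z)"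
proof -
  have "(\<Sum>z\<in>#A. g z) = (\<Sum>z\<in>S. of_nat (count A z) * g z)" if "set_mset A \<subseteq> S" for A
    using that
  proof (induction A)
    case (add x A)
    have "(\<Sum>z\<in>S. of_nat (count (add_mset x A) z) * g z)
        = (\<Sum>z\<in>S. (if z = x then g z else 0) + of_nat (count A z) * g z)"
      by (rule sum.cong) (auto simp: algebra_simps)
    also have "\<dots> = g x + (\<Sum>z\<in>#A. g z)"
      using add assms(2) by (simp add: sum.distrib)
    finally show ?case by simp
  qed simp
  from this[of "proots p"] show ?thesis using assms by simp
qed

text \<open>\<open>Re_inverse_B\<close> is the second equation of the Caratheodory pair, and
  \<open>cyclic\<close> is the kernel condition: \<open>cinner y c = 0\<close> says that
  \<open>U\<close> and \<open>V\<close> agree at \<open>y\<close>, so that both resolvents send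
  \<open>U x\<close> to \<open>y\<close>.\<close>

locale rank_one_perturbation =
  fixes U V :: "'a :: chilbert_space \<Rightarrow> 'a" and c :: 'a and B :: complex
  assumes U: "unitary_op U"
    and V: "unitary_op V"
    and V_eq: "V x = U x + (B * cinner x c) *\<^sub>C U c"
    and B: "B \<noteq> 0"
    and Re_inverse_B: "2 * Re (inverse B) = - (norm c)\<^sup>2"
    and c: "c \<noteq> 0"
    and cyclic: "(\<And>y z. cmod z \<noteq> 1 \<Longrightarrow> y - z *\<^sub>C inv U y = x \<Longrightarrow> cinner y c = 0) \<Longrightarrow> x = 0"
begin

lemmas lin_U = unitary_clinear[OF U]
lemmas lin_V = unitary_clinear[OF V]
lemmas unitary_W = unitary_inv[OF U]
lemmas lin_W = unitary_clinear[OF unitary_W]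

lemma U_inv [simp]: "U (inv U x) = x" and inv_U [simp]: "inv U (U x) = x"
  using unitary_bij[OF U] by (simp_all add: bij_def surj_f_inv_f)

lemma cinner_inv_U: "cinner (inv U x) y = cinner x (U y)"
  using U U_inv[of x] unfolding unitary_op_def by metis

text \<open>Meaningful off the unit circle, where the map being inverted is bijective.\<close>

definition h :: "complex \<Rightarrow> 'a \<Rightarrow> 'a"
  where "h z = inv (\<lambda>x. x - z *\<^sub>C inv U x)"

lemma h_left: "cmod z \<noteq> 1 \<Longrightarrow> h z (y - z *\<^sub>C inv U y) = y"
  unfolding h_def by (rule inv_unitary_resolvent[OF unitary_W])

lemma h_right: "cmod z \<noteq> 1 \<Longrightarrow> h z x - z *\<^sub>C inv U (h z x) = x"
  by (metis h_left unitary_resolvent_surj[OF unitary_W])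

lemma h_eqI: "cmod z \<noteq> 1 \<Longrightarrow> y - z *\<^sub>C inv U y = x \<Longrightarrow> h z x = y"
  using h_left by blast

lemma clinear_h:
  assumes "cmod z \<noteq> 1"
  shows "clinear (h z)"
proof (rule clinearI; rule h_eqI[OF assms])
  fix x y a
  let ?u = "h z x" and ?v = "h z y"
  have "?u + ?v - z *\<^sub>C inv U (?u + ?v) = (?u - z *\<^sub>C inv U ?u) + (?v - z *\<^sub>C inv U ?v)"
    by (simp add: clinear_add[OF lin_W] scaleC.add_right)
  then show "?u + ?v - z *\<^sub>C inv U (?u + ?v) = x + y" by (simp add: h_right[OF assms])
  have "a *\<^sub>C ?u - z *\<^sub>C inv U (a *\<^sub>C ?u) = a *\<^sub>C (?u - z *\<^sub>C inv U ?u)"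
    by (simp add: clinear_scaleC[OF lin_W] scaleC.diff_right scaleC_scaleC mult.commute)
  then show "a *\<^sub>C ?u - z *\<^sub>C inv U (a *\<^sub>C ?u) = a *\<^sub>C x" by (simp add: h_right[OF assms])
qed

lemma cmod_h_le:
  assumes "cmod z \<noteq> 1"
  shows "cmod (cinner (h z x) c) \<le> norm x * norm c / \<bar>1 - cmod z\<bar>"
proof -
  have "\<bar>1 - cmod z\<bar> * norm (h z x) \<le> norm x"
    using norm_unitary_resolvent_ge[OF unitary_W, of z "h z x"] by (simp add: h_right[OF assms])
  then have "norm (h z x) \<le> norm x / \<bar>1 - cmod z\<bar>"
    using assms by (simp add: field_simps)
  then have "norm (h z x) * norm c \<le> norm x / \<bar>1 - cmod z\<bar> * norm c"
    by (rule mult_right_mono) simp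
  then show ?thesis using cmod_cinner_le[of "h z x" c] by simp
qed

text \<open>Trades the scalar \<open>z\<close> for an application of \<open>U\<close>, at the price
  of a term that does not depend on \<open>z\<close>.\<close>

lemma scaleC_h:
  assumes "cmod z \<noteq> 1"
  shows "z *\<^sub>C h z x = h z (U x) - U x"
proof -
  let ?y = "h z x"
  have "(U x + z *\<^sub>C ?y) - z *\<^sub>C inv U (U x + z *\<^sub>C ?y) = U x + z *\<^sub>C (?y - z *\<^sub>C inv U ?y - x)"
    by (simp add: clinear_add[OF lin_W] clinear_scaleC[OF lin_W] scaleC.add_right scaleC.diff_right)
  also have "\<dots> = U x" by (simp add: h_right[OF assms] scaleC.zero_right)
  finally have "h z (U x) = U x + z *\<^sub>C ?y" by (rule h_eqI[OF assms])
  then show ?thesis by simp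
qed

text \<open>Iterating \<open>scaleC_h\<close> collects these error terms into a polynomial in
  \<open>z\<close>.\<close>

lemma power_h:
  assumes "cmod z \<noteq> 1"
  shows "z ^ j * cinner (h z x) c
    = cinner (h z ((U ^^ j) x)) c - (\<Sum>i<j. z ^ i * cinner ((U ^^ (j - i)) x) c)"
proof (induction j)
  case (Suc j)
  have "z * cinner (h z ((U ^^ j) x)) c
      = cinner (h z ((U ^^ Suc j) x)) c - cinner ((U ^^ Suc j) x) c"
    using arg_cong[OF scaleC_h[OF assms, of "(U ^^ j) x"], of "\<lambda>v. cinner v c"]
    by (simp add: cinner_scaleC_left cinner.diff_left)
  moreover have "z ^ Suc j * cinner (h z x) c
      = z * cinner (h z ((U ^^ j) x)) c - z * (\<Sum>i<j. z ^ i * cinner ((U ^^ (j - i)) x) c)"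
    using arg_cong[OF Suc, of "\<lambda>v. z * v"] by (simp add: right_diff_distrib mult.assoc)
  ultimately show ?case
    by (subst sum.lessThan_Suc_shift) (simp add: sum_distrib_left mult.assoc)
qed simp

text \<open>For \<open>k \<ge> 1\<close> and up to sign, the coefficient of \<open>z^(-k)\<close> in
  the expansion of \<open>cinner (h z c) c\<close> at infinity.\<close>

definition moment :: "nat \<Rightarrow> complex"
  where "moment k = cinner ((U ^^ k) c) c"

definition poly_U :: "complex poly \<Rightarrow> 'a"
  where "poly_U q = (\<Sum>j\<le>degree q. coeff q j *\<^sub>C (U ^^ j) c)"

text \<open>The negated polynomial part at infinity of \<open>q(z)\<close> times
  \<open>cinner (h z c) c\<close>.\<close>

definition remainder_poly :: "complex poly \<Rightarrow> complex poly"
  where "remainder_poly q = (\<Sum>j\<le>degree q. \<Sum>i<j. monom (coeff q j * moment (j - i)) i)"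

lemma coeff_remainder_poly:
  "coeff (remainder_poly q) m = (\<Sum>j\<in>{m<..degree q}. coeff q j * moment (j - m))"
proof -
  have "coeff (remainder_poly q) m
      = (\<Sum>j\<le>degree q. if m < j then coeff q j * moment (j - m) else 0)"
    by (simp add: remainder_poly_def coeff_sum)
  also have "\<dots> = (\<Sum>j\<in>{m<..degree q}. coeff q j * moment (j - m))"
    by (rule sum.mono_neutral_cong_right) auto
  finally show ?thesis .
qed

text \<open>\<open>power_h\<close> for each monomial of \<open>q\<close>. The first term on the
  right decays at infinity, the second is a polynomial.\<close>

lemma poly_times_h:
  assumes "cmod z \<noteq> 1"
  shows "poly q z * cinner (h z c) c = cinner (h z (poly_U q)) c - poly (remainder_poly q) z"
proof -
  have "poly q z * cinner (h z c) c = (\<Sum>j\<le>degree q. coeff q j * (z ^ j * cinner (h z c) c))"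
    by (simp add: poly_altdef sum_distrib_right mult.assoc)
  also have "\<dots> = (\<Sum>j\<le>degree q. coeff q j * cinner (h z ((U ^^ j) c)) c)
      - (\<Sum>j\<le>degree q. coeff q j * (\<Sum>i<j. z ^ i * cinner ((U ^^ (j - i)) c) c))"
    by (simp add: power_h[OF assms] right_diff_distrib sum_subtractf)
  also have "(\<Sum>j\<le>degree q. coeff q j * cinner (h z ((U ^^ j) c)) c) = cinner (h z (poly_U q)) c"
    by (simp add: poly_U_def clinear_sum[OF clinear_h[OF assms]] clinear_scaleC[OF clinear_h[OF assms]]
        cinner.sum_left cinner_scaleC_left)
  also have "(\<Sum>j\<le>degree q. coeff q j * (\<Sum>i<j. z ^ i * cinner ((U ^^ (j - i)) c) c))
      = poly (remainder_poly q) z"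
    by (simp add: remainder_poly_def poly_sum poly_monom moment_def sum_distrib_left mult_ac)
  finally show ?thesis .
qed

text \<open>The resolvent identity, with the moving point \<open>z\<close> in the outer resolvent,
  where \<open>cmod_h_le\<close> controls it.\<close>

lemma h_diff:
  assumes "cmod z \<noteq> 1" "cmod z0 \<noteq> 1"
  shows "h z x - h z0 x = h z ((z - z0) *\<^sub>C inv U (h z0 x))"
proof -
  let ?u = "h z x" and ?v = "h z0 x"
  have "(?u - ?v) - z *\<^sub>C inv U (?u - ?v)
      = (?u - z *\<^sub>C inv U ?u) - (?v - z0 *\<^sub>C inv U ?v) + (z - z0) *\<^sub>C inv U ?v"
    by (simp add: clinear_diff[OF lin_W] clinear_0[OF lin_W] scaleC.diff_right scaleC.diff_left
        scaleC.zero_right)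
  then have "(?u - ?v) - z *\<^sub>C inv U (?u - ?v) = (z - z0) *\<^sub>C inv U ?v"
    unfolding h_right[OF assms(1)] h_right[OF assms(2)] by simp
  from h_eqI[OF assms(1) this] show ?thesis by simp
qed

text \<open>
  The determinant of \<open>(I - w V) (I - w U)\<^sup>-\<^sup>1\<close>, expanded at \<open>w = 0\<close>.
\<close>

definition perturbation_fps :: "complex fps"
  where "perturbation_fps = Abs_fps (\<lambda>k. if k = 0 then 1 else - B * moment k)"

text \<open>Telescoping: in the \<open>j\<close>-th summand the rank one part acts after
  \<open>j\<close> steps of \<open>V\<close>, and \<open>U\<close> acts from then on.\<close>

lemma V_power_expansion:
  "(V ^^ l) x - (U ^^ l) x = (\<Sum>j<l. (B * cinner ((V ^^ j) x) c) *\<^sub>C (U ^^ (l - j)) c)"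
proof (induction l)
  case (Suc l)
  have "(V ^^ Suc l) x - (U ^^ Suc l) x
      = U ((V ^^ l) x - (U ^^ l) x) + (B * cinner ((V ^^ l) x) c) *\<^sub>C U c"
    by (simp add: V_eq clinear_diff[OF lin_U])
  also have "U ((V ^^ l) x - (U ^^ l) x)
      = (\<Sum>j<l. (B * cinner ((V ^^ j) x) c) *\<^sub>C (U ^^ (Suc l - j)) c)"
    unfolding Suc clinear_sum[OF lin_U] clinear_scaleC[OF lin_U]
    by (rule sum.cong) (simp_all add: Suc_diff_le less_imp_le)
  finally show ?case by simp
qed simp

text \<open>\<open>V_power_expansion\<close> at \<open>(U ^^ m) c\<close>, paired with
  \<open>c\<close>; the coefficient \<open>1\<close> of \<open>perturbation_fps\<close> at index
  \<open>0\<close> supplies the term with \<open>V ^^ n\<close>.\<close>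

lemma mixed_moment_convolution:
  "(\<Sum>j\<le>n. cinner ((V ^^ j) ((U ^^ m) c)) c * perturbation_fps $ (n - j)) = moment (n + m)"
proof -
  have "cinner ((V ^^ n) ((U ^^ m) c)) c - cinner ((U ^^ n) ((U ^^ m) c)) c
      = (\<Sum>j<n. B * cinner ((V ^^ j) ((U ^^ m) c)) c * moment (n - j))"
    unfolding cinner.diff_left[symmetric] V_power_expansion
    by (simp add: cinner.sum_left cinner_scaleC_left moment_def)
  moreover have "(\<Sum>j\<le>n. cinner ((V ^^ j) ((U ^^ m) c)) c * perturbation_fps $ (n - j))
      = cinner ((V ^^ n) ((U ^^ m) c)) c
        - (\<Sum>j<n. B * cinner ((V ^^ j) ((U ^^ m) c)) c * moment (n - j))"
    unfolding lessThan_Suc_atMost[symmetric] sum.lessThan_Suc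
    by (simp add: perturbation_fps_def sum_negf[symmetric] mult_ac)
  moreover have "moment (n + m) = cinner ((U ^^ n) ((U ^^ m) c)) c"
    by (simp add: moment_def funpow_add)
  ultimately show ?thesis by (simp add: algebra_simps)
qed

text \<open>The summands of \<open>V_power_expansion\<close> have rank one, and the trace of
  \<open>x \<mapsto> \<langle>S x, c\<rangle> b\<close> is
  \<open>\<langle>S b, c\<rangle>\<close>.\<close>

lemma trace_power_diff:
  assumes "finite F" "is_onb F"
  shows "(\<Sum>f\<in>F. cinner ((V ^^ l) f - (U ^^ l) f) f)
    = (\<Sum>j<l. B * cinner ((V ^^ j) ((U ^^ (l - j)) c)) c)"
proof -
  have pairing: "(\<Sum>f\<in>F. cinner (T f) c * cinner b f) = cinner (T b) c" if T: "clinear T" for T b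
  proof -
    have "cinner (T b) c = cinner (T (\<Sum>f\<in>F. cinner b f *\<^sub>C f)) c"
      by (simp add: onb_expansion[OF assms])
    then show ?thesis
      by (simp add: clinear_sum[OF T] clinear_scaleC[OF T] cinner.sum_left cinner_scaleC_left mult.commute)
  qed
  have "(\<Sum>f\<in>F. cinner ((V ^^ l) f - (U ^^ l) f) f)
      = (\<Sum>f\<in>F. \<Sum>j<l. B * (cinner ((V ^^ j) f) c * cinner ((U ^^ (l - j)) c) f))"
    by (simp add: V_power_expansion cinner.sum_left cinner_scaleC_left mult.assoc)
  also have "\<dots> = (\<Sum>j<l. B * (\<Sum>f\<in>F. cinner ((V ^^ j) f) c * cinner ((U ^^ (l - j)) c) f))"
    by (subst sum.swap) (simp add: sum_distrib_left)
  also have "\<dots> = (\<Sum>j<l. B * cinner ((V ^^ j) ((U ^^ (l - j)) c)) c)"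
    by (simp add: pairing[OF clinear_funpow[OF lin_V]])
  finally show ?thesis .
qed

lemma perturbation_fps_log_derivative:
  assumes "finite F" "is_onb F"
  defines "T \<equiv> Abs_fps (\<lambda>l. \<Sum>f\<in>F. cinner ((V ^^ l) f - (U ^^ l) f) f)"
  shows "perturbation_fps * T = - (fps_X * fps_deriv perturbation_fps)"
proof (rule fps_ext)
  fix n
  let ?D = "\<lambda>k. perturbation_fps $ k" and ?X = "\<lambda>j m. cinner ((V ^^ j) ((U ^^ m) c)) c"
  have "(perturbation_fps * T) $ n = (\<Sum>l\<le>n. T $ l * ?D (n - l))"
    by (subst mult.commute) (simp add: fps_mult_nth atLeast0AtMost)
  also have "\<dots> = (\<Sum>l\<le>n. \<Sum>j<l. B * ?X j (l - j) * ?D (n - l))"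
    by (simp add: T_def trace_power_diff[OF assms(1,2)] sum_distrib_right)
  also have "\<dots> = (\<Sum>(l, j)\<in>(SIGMA l:{..n}. {..<l}). B * ?X j (l - j) * ?D (n - l))"
    by (rule sum.Sigma) auto
  \<comment> \<open>With \<open>m = l - j\<close> the inner sum becomes the convolution of
    \<open>mixed_moment_convolution\<close>. Its value \<open>moment n\<close> does not depend on
    \<open>m\<close>, and the \<open>n\<close> equal terms produce the factor \<open>n\<close> of
    the derivative.\<close>
  also have "\<dots> = (\<Sum>(m, j)\<in>(SIGMA m:{1..n}. {..n - m}). B * (?X j m * ?D (n - m - j)))"
    by (rule sum.reindex_bij_witness[of _ "\<lambda>(m, j). (m + j, j)" "\<lambda>(l, j). (l - j, j)"]) auto
  also have "\<dots> = (\<Sum>m\<in>{1..n}. \<Sum>j\<le>n - m. B * (?X j m * ?D (n - m - j)))"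
    by (rule sum.Sigma[symmetric]) auto
  also have "\<dots> = (\<Sum>m\<in>{1..n}. B * moment n)"
    unfolding sum_distrib_left[symmetric] mixed_moment_convolution by simp
  also have "\<dots> = (- (fps_X * fps_deriv perturbation_fps)) $ n"
    by (cases n) (simp_all add: perturbation_fps_def)
  finally show "(perturbation_fps * T) $ n = (- (fps_X * fps_deriv perturbation_fps)) $ n" .
qed

end

section \<open>Consequences of the rationality of the Caratheodory function\<close>

locale rational_rank_one_perturbation = rank_one_perturbation +
  fixes p q :: "complex poly"
  assumes q: "q \<noteq> 0" and coprime: "coprime p q"
    and quotient: "cmod z \<noteq> 1 \<Longrightarrow> poly p z / poly q z = inverse B + cinner (h z c) c"
begin

text \<open>Off the circle and the roots of \<open>q\<close>, the polynomial \<open>P\<close> equals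
  \<open>cinner (h z (poly_U q)) c\<close>, which tends to zero at infinity. A polynomial with that
  limit vanishes.\<close>

lemma p_eq: "p = smult (inverse B) q - remainder_poly q"
proof -
  define P where "P = p - smult (inverse B) q + remainder_poly q"
  have P: "poly P z = cinner (h z (poly_U q)) c" if "cmod z \<noteq> 1" "poly q z \<noteq> 0" for z
  proof -
    have "poly p z = poly q z * inverse B + poly q z * cinner (h z c) c"
      using quotient[OF that(1)] that(2) by (simp add: field_simps)
    then show ?thesis using poly_times_h[OF that(1), of q] by (simp add: P_def)
  qed
  define K where "K = norm (poly_U q) * norm c"
  have "(poly P \<longlongrightarrow> 0) at_infinity"
  proof (rule Lim_null_comparison)
    have "\<forall>\<^sub>F z in at_infinity. \<forall>w\<in>{w. poly q w = 0}. z \<noteq> w"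
      using poly_roots_finite[OF q]
      by (intro eventually_ball_finite ballI eventually_not_equal_at_infinity)
    moreover have "\<forall>\<^sub>F z :: complex in at_infinity. cmod z \<ge> 2"
      by (rule eventually_at_infinityI) 
    ultimately show "\<forall>\<^sub>F z in at_infinity. norm (poly P z) \<le> K / (cmod z - 1)"
    proof eventually_elim
      case (elim z)
      then have "cmod z \<noteq> 1" "poly q z \<noteq> 0" by auto
      then show ?case
        using cmod_h_le[of z "poly_U q"] elim(2) by (simp add: P K_def)
    qed
    have "filterlim (\<lambda>z :: complex. - 1 + cmod z) at_top at_infinity"
      by (rule filterlim_tendsto_add_at_top[OF tendsto_const filterlim_norm_at_top])
    then have "filterlim (\<lambda>z :: complex. cmod z - 1) at_top at_infinity"
      by (simp add: add.commute)
    then show "((\<lambda>z :: complex. K / (cmod z - 1)) \<longlongrightarrow> 0) at_infinity"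
      by (intro tendsto_divide_0[OF tendsto_const] filterlim_at_top_imp_at_infinity)
  qed
  then have "\<not> degree P > 0"
    using filterlim_poly_at_infinity[of P] not_tendsto_and_filterlim_at_infinity
      trivial_limit_at_infinity by blast
  then obtain a where a: "P = [:a:]" by (auto elim: degree_eq_zeroE)
  then have "((\<lambda>_ :: complex. a) \<longlongrightarrow> 0) at_infinity"
    using \<open>(poly P \<longlongrightarrow> 0) at_infinity\<close> 
    by (simp add: a fun_eq_iff[THEN iffD2, of "poly [:a:]" "\<lambda>_. a"])
  then have "P = 0"
    unfolding a by (simp add: tendsto_const_iff[OF trivial_limit_at_infinity])
  then show ?thesis by (simp add: P_def algebra_simps)
qed

text \<open>At a root of \<open>q\<close> off the circle the quotient says nothing, hence the limit argument.\<close>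

lemma h_poly_U_eq_0:
  assumes "cmod z0 \<noteq> 1"
  shows "cinner (h z0 (poly_U q)) c = 0"
proof -
  define x where "x = poly_U q"
  have zero: "cinner (h z x) c = 0" if "cmod z \<noteq> 1" "poly q z \<noteq> 0" for z
  proof -
    have "poly p z = poly q z * inverse B + poly q z * cinner (h z c) c"
      using quotient[OF that(1)] that(2) by (simp add: field_simps)
    moreover have "poly p z = inverse B * poly q z - poly (remainder_poly q) z"
      by (subst p_eq) simp
    ultimately show ?thesis using poly_times_h[OF that(1), of q] by (simp add: x_def)
  qed
  define K where "K = norm (inv U (h z0 x)) * norm c"
  have "((\<lambda>z. cmod (z - z0) * K / \<bar>1 - cmod z\<bar>) \<longlongrightarrow> cmod (z0 - z0) * K / \<bar>1 - cmod z0\<bar>) (at z0)"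
    using assms by (intro tendsto_intros) auto
  \<comment> \<open>The value vanishes at the points \<open>z\<close> near \<open>z0\<close>, so the
    resolvent identity bounds the value at \<open>z0\<close> by a multiple of
    \<open>cmod (z - z0)\<close>.\<close>
  moreover have "\<forall>\<^sub>F z in at z0. cmod (cinner (h z0 x) c) \<le> cmod (z - z0) * K / \<bar>1 - cmod z\<bar>"
  proof -
    have "\<forall>\<^sub>F z in at z0. z \<notin> {z. poly q z = 0}"
      using islimpt_finite[OF poly_roots_finite[OF q]] islimpt_iff_eventually by blast
    moreover have "\<forall>\<^sub>F z in at z0. cmod z \<noteq> 1"
      using assms by (intro tendsto_imp_eventually_ne[of _ "cmod z0"] tendsto_intros)
    ultimately show ?thesis
    proof eventually_elim
      case (elim z)
      then have z: "cinner (h z x) c = 0" using zero by simp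
      have "cinner (h z x) c - cinner (h z0 x) c = cinner (h z ((z - z0) *\<^sub>C inv U (h z0 x))) c"
        by (simp add: h_diff[OF elim(2) assms] flip: cinner.diff_left)
      then have "cmod (cinner (h z0 x) c) = cmod (cinner (h z ((z - z0) *\<^sub>C inv U (h z0 x))) c)"
        by (metis z diff_0 norm_minus_cancel)
      also have "\<dots> \<le> cmod (z - z0) * K / \<bar>1 - cmod z\<bar>"
        using cmod_h_le[OF elim(2), of "(z - z0) *\<^sub>C inv U (h z0 x)"]
        by (simp add: norm_scaleC K_def mult.assoc)
      finally show ?case .
    qed
  qed
  ultimately have "cmod (cinner (h z0 x) c) \<le> cmod (z0 - z0) * K / \<bar>1 - cmod z0\<bar>"
    by (rule tendsto_lowerbound) simp
  then show ?thesis by (simp add: x_def)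
qed

lemma poly_U_eq_0: "poly_U q = 0"
  by (rule cyclic) (metis h_left h_poly_U_eq_0)

text \<open>With \<open>poly_U q = 0\<close>, \<open>poly_times_h\<close> makes the remainder vanish
  at a root of \<open>q\<close> off the circle; then \<open>p\<close> vanishes there too, against
  coprimality.\<close>

lemma q_root_on_circle:
  assumes "poly q z = 0"
  shows "cmod z = 1"
proof (rule ccontr)
  assume z: "cmod z \<noteq> 1"
  have "poly p z = 0"
    using poly_times_h[OF z, of q] assms poly_U_eq_0 clinear_0[OF clinear_h[OF z]]
    by (subst p_eq) (simp add: cinner.zero_left)
  then show False using coprime_poly_0[OF coprime, of z] assms by simp
qed

text \<open>At a zero off the circle, \<open>Re_inverse_B\<close> turns the vanishing real part into
  \<open>norm (y - c) = norm y\<close> for \<open>y = h z c\<close>. But \<open>y - c\<close> is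
  \<open>z\<close> times an isometric image of \<open>y\<close>, so
  \<open>cmod z = 1\<close>.\<close>

lemma p_root_on_circle:
  assumes "poly p z = 0"
  shows "cmod z = 1"
proof (rule ccontr)
  assume z: "cmod z \<noteq> 1"
  let ?y = "h z c"
  have y: "?y - z *\<^sub>C inv U ?y = c" by (rule h_right[OF z])
  then have "?y \<noteq> 0" using c by (auto simp: clinear_0[OF lin_W] scaleC.zero_right)
  have "?y - c = z *\<^sub>C inv U ?y" using y by (metis add_diff_cancel_left' diff_add_cancel)
  then have "(norm (?y - c))\<^sup>2 = (cmod z)\<^sup>2 * (norm ?y)\<^sup>2"
    by (simp add: norm_scaleC norm_unitary[OF unitary_W] power_mult_distrib)
  moreover have "(norm (?y - c))\<^sup>2 = (norm ?y)\<^sup>2 - 2 * (?y \<bullet> c) + (norm c)\<^sup>2"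
    by (simp add: power2_norm_eq_inner inner_diff_left inner_diff_right inner_commute)
  moreover have "2 * (?y \<bullet> c) = (norm c)\<^sup>2"
  proof -
    have "inverse B + cinner ?y c = 0" using quotient[OF z] assms by simp
    then have "Re (inverse B) + Re (cinner ?y c) = 0" by (metis plus_complex.sel(1) zero_complex.sel(1))
    then show ?thesis using Re_inverse_B by (simp only: Re_cinner)
  qed
  ultimately have "(cmod z)\<^sup>2 * (norm ?y)\<^sup>2 = (norm ?y)\<^sup>2" by simp
  then have "(cmod z)\<^sup>2 = 1" using \<open>?y \<noteq> 0\<close> by simp
  then show False using z norm_ge_zero[of z] by (auto simp: power2_eq_1_iff simp del: norm_ge_zero)
qed

text \<open>The iterates \<open>(U ^^ k) c\<close> with \<open>k < degree q\<close> have trivial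
  orthogonal complement, so orthonormalizing them gives a basis. For \<open>x\<close> orthogonal to
  them, the pairings of \<open>y\<close> with the iterates form a geometric progression, which is
  tested against \<open>poly_U q = 0\<close>.\<close>

lemma finite_onb_exists: "\<exists>F :: 'a set. finite F \<and> is_onb F"
proof -
  let ?N = "degree q"
  have orth: "x = 0" if x: "\<And>k. k < ?N \<Longrightarrow> cinner x ((U ^^ k) c) = 0" for x
  proof (rule cyclic)
    fix y z assume z: "cmod z \<noteq> 1" and y: "y - z *\<^sub>C inv U y = x"
    let ?a = "\<lambda>k. cinner y ((U ^^ k) c)"
    have step: "?a k = z * ?a (Suc k)" if "k < ?N" for k
      using x[OF that] unfolding y[symmetric]
      by (simp add: cinner.diff_left cinner_scaleC_left cinner_inv_U)
    show "cinner y c = 0"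
    proof (cases "z = 0")
      \<comment> \<open>At \<open>z = 0\<close> the progression cannot be inverted, but
        \<open>step\<close> at \<open>0\<close> gives the claim, provided \<open>q\<close> is not
        constant.\<close>
      case True
      have "?N \<noteq> 0"
      proof
        assume "?N = 0"
        then have "coeff q 0 *\<^sub>C c = 0" using poly_U_eq_0 by (simp add: poly_U_def)
        then have "coeff q 0 = 0" using c norm_scaleC[of "coeff q 0" c] by simp
        then show False using q \<open>?N = 0\<close> leading_coeff_0_iff[of q] by simp
      qed
      then show ?thesis using step[of 0] True by simp
    next
      case False
      have a: "?a k = inverse z ^ k * ?a 0" if "k \<le> ?N" for k
        using that
      proof (induction k)
        case (Suc k)
        then show ?case using step[of k] False by (simp add: field_simps)
      qed simp
      have "0 = cinner y (poly_U q)" by (simp add: poly_U_eq_0 cinner.zero_right)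
      also have "\<dots> = (\<Sum>k\<le>?N. cnj (coeff q k) * ?a k)"
        by (simp add: poly_U_def cinner.sum_right cinner_scaleC_right)
      also have "\<dots> = (\<Sum>k\<le>?N. cnj (coeff q k * inverse (cnj z) ^ k) * ?a 0)"
      proof (rule sum.cong)
        fix k assume "k \<in> {..?N}"
        then show "cnj (coeff q k) * ?a k = cnj (coeff q k * inverse (cnj z) ^ k) * ?a 0"
          using a[of k] by simp
      qed simp
      also have "\<dots> = cnj (poly q (inverse (cnj z))) * ?a 0"
        by (simp add: poly_altdef sum_distrib_right)
      finally have "poly q (inverse (cnj z)) = 0 \<or> ?a 0 = 0" by simp
      moreover have "poly q (inverse (cnj z)) \<noteq> 0"
        using q_root_on_circle[of "inverse (cnj z)"] z by (auto simp: norm_inverse)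
      ultimately show ?thesis by simp
    qed
  qed
  obtain F where F: "finite F" "orthonormal F"
    "\<And>y. (\<forall>e\<in>F. cinner y e = 0) \<Longrightarrow> \<forall>s\<in>(\<lambda>k. (U ^^ k) c) ` {..<?N}. cinner y s = 0"
    using gram_schmidt[of "(\<lambda>k. (U ^^ k) c) ` {..<?N}"] by blast
  have "is_onb F"
    by (rule finite_onbI[OF F(1,2)], rule orth) (use F(3) in blast)
  then show ?thesis using F(1) by blast
qed

lemma coeff_p:
  "B * coeff p m = (\<Sum>j\<in>{m..degree q}. coeff q j * perturbation_fps $ (j - m))"
proof -
  have "B * coeff p m = coeff q m - (\<Sum>j\<in>{m<..degree q}. coeff q j * (B * moment (j - m)))"
    using B by (subst p_eq) (simp add: coeff_remainder_poly right_diff_distrib sum_distrib_left mult_ac)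
  also have "\<dots> = coeff q m + (\<Sum>j\<in>{m<..degree q}. coeff q j * perturbation_fps $ (j - m))"
    by (simp add: perturbation_fps_def sum_negf)
  also have "\<dots> = (\<Sum>j\<in>{m..degree q}. coeff q j * perturbation_fps $ (j - m))"
  proof (cases "m \<le> degree q")
    case True
    then have "{m..degree q} = insert m {m<..degree q}" by auto
    then show ?thesis by (simp add: perturbation_fps_def)
  qed (simp add: coeff_eq_0)
  finally show ?thesis .
qed

text \<open>At the top index \<open>coeff_p\<close> compares leading coefficients:
  \<open>p / q\<close> has the finite nonzero value \<open>inverse B\<close> at infinity.\<close>

lemma degree_p: "degree p = degree q"
proof (rule antisym)
  have "coeff p m = 0" if "m > degree q" for m
    using coeff_p[of m] that B by simp
  then show "degree p \<le> degree q" by (simp add: degree_le)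
  have "coeff p (degree q) \<noteq> 0"
    using coeff_p[of "degree q"] q B by (auto simp: perturbation_fps_def)
  then show "degree q \<le> degree p" by (rule le_degree)
qed

text \<open>This is \<open>D(w) = B \<Phi>(1/w)\<close>; equal degrees let the reversals implement
  \<open>1/w\<close>. Up to index \<open>degree q\<close> it is \<open>coeff_p\<close> read
  backwards, and beyond that the recurrence for the moments given by
  \<open>poly_U q = 0\<close>.\<close>

lemma perturbation_fps_quotient:
  "perturbation_fps * fps_of_poly (reflect_poly q) = fps_const B * fps_of_poly (reflect_poly p)"
proof (rule fps_ext)
  fix n
  let ?N = "degree q" and ?D = "\<lambda>k. perturbation_fps $ k"
  have lhs: "(perturbation_fps * fps_of_poly (reflect_poly q)) $ n
      = (\<Sum>i\<in>{n - ?N..n}. coeff q (?N - (n - i)) * ?D i)"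
    unfolding fps_mult_nth fps_of_poly_nth
    by (rule sum.mono_neutral_cong_right) (auto simp: coeff_reflect_poly)
  show "(perturbation_fps * fps_of_poly (reflect_poly q)) $ n
      = (fps_const B * fps_of_poly (reflect_poly p)) $ n"
  proof (cases "n \<le> ?N")
    case True
    have "(\<Sum>i\<in>{n - ?N..n}. coeff q (?N - (n - i)) * ?D i)
        = (\<Sum>j\<in>{?N - n..?N}. coeff q j * ?D (j - (?N - n)))"
      by (rule sum.reindex_bij_witness[of _ "\<lambda>j. j - (?N - n)" "\<lambda>i. ?N - (n - i)"])
         (use True in auto)
    also have "\<dots> = B * coeff p (?N - n)" by (rule coeff_p[symmetric])
    finally show ?thesis
      using True unfolding lhs by (simp add: coeff_reflect_poly degree_p)
  next
    case False
    have "(\<Sum>i\<in>{n - ?N..n}. coeff q (?N - (n - i)) * ?D i)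
        = (\<Sum>j\<le>?N. coeff q j * ?D (j + (n - ?N)))"
      by (rule sum.reindex_bij_witness[of _ "\<lambda>j. j + (n - ?N)" "\<lambda>i. ?N - (n - i)"])
         (use False in auto)
    \<comment> \<open>Here \<open>n > ?N\<close>, so every index is positive and the exceptional
      coefficient at \<open>0\<close> does not occur.\<close>
    also have "\<dots> = - B * cinner ((U ^^ (n - ?N)) (poly_U q)) c"
    proof -
      have "?D (j + (n - ?N)) = - B * cinner ((U ^^ (n - ?N)) ((U ^^ j) c)) c" for j
      proof -
        have "moment (j + (n - ?N)) = cinner ((U ^^ (n - ?N)) ((U ^^ j) c)) c"
          by (simp only: moment_def add.commute[of j] funpow_add o_apply)
        then show ?thesis using False by (simp add: perturbation_fps_def)
      qed
      then show ?thesis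
        by (simp add: poly_U_def clinear_sum[OF clinear_funpow[OF lin_U]]
            clinear_scaleC[OF clinear_funpow[OF lin_U]] cinner.sum_left cinner_scaleC_left
            sum_distrib_left sum_negf mult_ac)
    qed
    also have "\<dots> = 0"
      by (simp add: poly_U_eq_0 clinear_0[OF clinear_funpow[OF lin_U]] cinner.zero_left)
    finally show ?thesis
      using False unfolding lhs by (simp add: coeff_reflect_poly degree_p)
  qed
qed

lemma trace_power_diff_eq_power_sums:
  assumes "finite F" "is_onb F"
  shows "(\<Sum>f\<in>F. cinner ((V ^^ l) f - (U ^^ l) f) f)
    = (\<Sum>z\<in>#proots p. z ^ l) - (\<Sum>z\<in>#proots q. z ^ l)"
proof -
  have "p \<noteq> 0" using coeff_p[of "degree q"] q B by (auto simp: perturbation_fps_def)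
  from log_derivative_fps_quotient[OF this q degree_p B perturbation_fps_quotient
      perturbation_fps_log_derivative[OF assms]]
  show ?thesis by (simp add: fps_eq_iff power_sum_fps_def)
qed

end

section \<open>The trace formula\<close>

text \<open>Applying \<open>inv U\<close> reduces injectivity of \<open>U - z I\<close> to that of
  \<open>I - z U^(-1)\<close>.\<close>

lemma resolvent_eqI:
  assumes U: "unitary_op U" and z: "cmod z \<noteq> 1" and x: "U y - z *\<^sub>C y = x"
  shows "resolvent U z x = y"
proof -
  have "inj (\<lambda>y. U y - z *\<^sub>C y)"
  proof (rule injI)
    fix a b assume "U a - z *\<^sub>C a = U b - z *\<^sub>C b"
    from arg_cong[OF this, of "inv U"] have "a - z *\<^sub>C inv U a = b - z *\<^sub>C inv U b"
      using unitary_clinear[OF unitary_inv[OF U]] unitary_bij[OF U]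
      by (simp add: clinear_diff clinear_scaleC bij_is_inj)
    then show "a = b" by (rule unitary_resolvent_inj[OF unitary_inv[OF U] z])
  qed
  then show ?thesis
    unfolding resolvent_def x[symmetric] by (rule inv_f_f)
qed

lemma cdim_zero: "cdim {0 :: 'a :: chilbert_space} = 0"
  using cvec.dim_unique[of "{}" "{0}" 0] cvec.independent_empty by simp

lemma power_series_op_sums:
  assumes "unitary_op U" "summable (\<lambda>l. cmod (a l))"
  shows "(\<lambda>l. a l *\<^sub>C (U ^^ l) x) sums power_series_op a U x"
proof -
  have "summable (\<lambda>l. norm (a l *\<^sub>C (U ^^ l) x))"
    by (simp add: norm_scaleC norm_unitary_power[OF assms(1)] summable_mult2 assms(2))
  from summable_sums[OF summable_norm_cancel[OF this]] show ?thesis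
    unfolding power_series_op_def .
qed

lemma clinear_power_series_op:
  assumes "unitary_op U" "summable (\<lambda>l. cmod (a l))"
  shows "clinear (power_series_op a U)"
proof (rule clinearI)
  note sums = power_series_op_sums[OF assms]
  note lin = clinear_funpow[OF unitary_clinear[OF assms(1)]]
  fix x y b
  have "(\<lambda>l. a l *\<^sub>C (U ^^ l) (x + y)) sums (power_series_op a U x + power_series_op a U y)"
    using sums_add[OF sums[of x] sums[of y]] by (simp add: clinear_add[OF lin] scaleC.add_right)
  then show "power_series_op a U (x + y) = power_series_op a U x + power_series_op a U y"
    by (rule sums_unique2[OF sums])
  have "a l *\<^sub>C (U ^^ l) (b *\<^sub>C x) = b *\<^sub>C a l *\<^sub>C (U ^^ l) x" for l
    by (simp add: clinear_scaleC[OF lin] scaleC_scaleC mult.commute)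
  then have "(\<lambda>l. a l *\<^sub>C (U ^^ l) (b *\<^sub>C x)) sums (b *\<^sub>C power_series_op a U x)"
    using bounded_linear.sums[OF scaleC.bounded_linear_right sums[of x], of b] by simp
  then show "power_series_op a U (b *\<^sub>C x) = b *\<^sub>C power_series_op a U x"
    by (rule sums_unique2[OF sums])
qed

lemma trace_power_series_diff_sums:
  assumes "unitary_op U" "unitary_op V" "summable (\<lambda>l. cmod (a l))"
  shows "(\<lambda>l. a l * (\<Sum>f\<in>F. cinner ((V ^^ l) f - (U ^^ l) f) f))
    sums (\<Sum>f\<in>F. cinner (power_series_op a V f - power_series_op a U f) f)"
proof -
  have "(\<lambda>l. a l * cinner ((V ^^ l) f - (U ^^ l) f) f)
      sums cinner (power_series_op a V f - power_series_op a U f) f" for f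
    unfolding cinner_scaleC_left[symmetric] scaleC.diff_right
    by (intro bounded_linear.sums[OF cinner.bounded_linear_left] sums_diff power_series_op_sums assms)
  then have "(\<lambda>l. \<Sum>f\<in>F. a l * cinner ((V ^^ l) f - (U ^^ l) f) f)
      sums (\<Sum>f\<in>F. cinner (power_series_op a V f - power_series_op a U f) f)"
    by (rule sums_sum)
  then show ?thesis by (simp add: sum_distrib_left)
qed

lemma power_sums_sums:
  fixes f :: "complex \<Rightarrow> complex"
  assumes "\<And>z. z \<in># A \<Longrightarrow> (\<lambda>l. a l * z ^ l) sums f z"
  shows "(\<lambda>l. a l * (\<Sum>z\<in>#A. z ^ l)) sums (\<Sum>z\<in>#A. f z)"
  using assms by (induction A) (simp_all add: distrib_left sums_add)

theorem theorem7p6: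
  fixes Up Um :: "'a :: chilbert_space \<Rightarrow> 'a"
    and C :: "'a \<Rightarrow> complex" and B :: complex
    and \<Phi> :: "complex \<Rightarrow> complex"
    and f :: "complex \<Rightarrow> complex" and fc :: "nat \<Rightarrow> complex"
    and R0 :: real and n :: nat
  assumes "unitary_op Up" and "unitary_op Um"
    and "(\<Inter>z\<in>- sphere 0 1. {x. resolvent Up z x - resolvent Um z x = 0}) = {0}"
    and "\<And>z. z \<notin> sphere 0 1 \<Longrightarrow>
           cdim (range (\<lambda>x. resolvent Up z x - resolvent Um z x)) = n"
    and "n = 1"
    and "caratheodory_data Up Um C B"
    and "rational_function \<Phi>"
    and "\<And>z. z \<notin> sphere 0 1 \<Longrightarrow> \<Phi> z = caratheodory_fun Up C B z"
    and "\<And>z. z \<notin> sphere 0 1 \<Longrightarrow> z \<noteq> 0 \<Longrightarrow> \<Phi> z = - cnj (\<Phi> (1 / cnj z))"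
    and "R0 > 1"
    and "f analytic_on ball 0 R0"
    and "\<And>z. z \<in> ball 0 R0 \<Longrightarrow> (\<lambda>l. fc l * z ^ l) sums f z"
  shows "poles_and_zeros \<Phi> \<subseteq> sphere 0 1 \<and>
    trace_class (\<lambda>x. power_series_op fc Um x - power_series_op fc Up x) \<and>
    op_trace (\<lambda>x. power_series_op fc Um x - power_series_op fc Up x) =
      (\<Sum>z\<in>poles_and_zeros \<Phi>. of_int (zorder \<Phi> z) * f z)"
proof -
  note Up = assms(1) and Um = assms(2)
  have data: "bounded_clinear C" "cmod B = 1" "x - inv Up (Um x) = - cadjoint C (B * C x)"
    "inverse B + cnj (inverse B) = - C (cadjoint C 1)" for x
    using assms(6) by (simp_all add: caratheodory_data_def cadjoint_unitary[OF Up])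
  obtain c where C: "\<And>x. C x = cinner x c"
    using riesz_representation[OF data(1)] by blast
  have adj: "cadjoint C w = w *\<^sub>C c" for w
    by (rule cadjoint_functional[OF C])
  have Up_inv: "Up (inv Up x) = x" for x
    using unitary_bij[OF Up] by (simp add: bij_is_surj surj_f_inv_f)
  have Um_eq: "Um x = Up x + (B * cinner x c) *\<^sub>C Up c" for x
  proof -
    have "inv Up (Um x) = x + (B * cinner x c) *\<^sub>C c"
      using data(3)[of x] by (simp add: adj C algebra_simps)
    from arg_cong[OF this, of Up] show ?thesis
      by (simp add: Up_inv clinear_add[OF unitary_clinear[OF Up]] clinear_scaleC[OF unitary_clinear[OF Up]])
  qed
  have c: "c \<noteq> 0"
  proof
    \<comment> \<open>The resolvents would coincide and their difference would have range
      \<open>{0}\<close>, of dimension \<open>0\<close> instead of \<open>1\<close>.\<close>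
    assume "c = 0"
    then have "Um = Up" using Um_eq by (auto simp: cinner.zero_right scaleC.zero_left)
    then show False using assms(4)[of 0] assms(5) by (simp add: cdim_zero)
  qed
  interpret rank_one_perturbation Up Um c B
  proof
    show "B \<noteq> 0" using data(2) by auto
    have "complex_of_real (2 * Re (inverse B)) = inverse B + cnj (inverse B)"
      by (rule complex_add_cnj[symmetric])
    also have "\<dots> = of_real (- (norm c)\<^sup>2)"
      by (simp only: data(4) adj C scaleC_one cinner_self of_real_minus)
    finally show "2 * Re (inverse B) = - (norm c)\<^sup>2" by (simp only: of_real_eq_iff)
    \<comment> \<open>The kernel hypothesis is applied to \<open>Up x\<close>: orthogonality of
      \<open>y\<close> to \<open>c\<close> makes \<open>Up\<close> and \<open>Um\<close> agree at
      \<open>y\<close>, so both resolvents take the value \<open>y\<close> there.\<close>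
    fix x assume x: "\<And>y z. cmod z \<noteq> 1 \<Longrightarrow> y - z *\<^sub>C inv Up y = x \<Longrightarrow> cinner y c = 0"
    have "resolvent Up z (Up x) = resolvent Um z (Up x)" if z: "cmod z \<noteq> 1" for z
    proof -
      obtain y where y: "y - z *\<^sub>C inv Up y = x"
        using unitary_resolvent_surj[OF unitary_inv[OF Up] z] by blast
      from arg_cong[OF this, of Up] have "Up y - z *\<^sub>C y = Up x"
        by (simp add: Up_inv clinear_diff[OF unitary_clinear[OF Up]] clinear_scaleC[OF unitary_clinear[OF Up]])
      moreover from this have "Um y - z *\<^sub>C y = Up x"
        using x[OF z y] by (simp add: Um_eq scaleC.zero_left)
      ultimately show ?thesis using resolvent_eqI[OF Up z] resolvent_eqI[OF Um z] by metis
    qed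
    then have "Up x \<in> (\<Inter>z\<in>- sphere 0 1. {x. resolvent Up z x - resolvent Um z x = 0})"
      by simp
    then have "Up x = 0" using assms(3) by blast
    then show "x = 0" using norm_unitary[OF Up, of x] by simp
  qed (use Up Um Um_eq c in auto)
  obtain p q where q: "q \<noteq> 0" and pq: "coprime p q" and \<Phi>: "\<Phi> = (\<lambda>z. poly p z / poly q z)"
    using assms(7) by (auto simp: rational_function_def)
  interpret rational_rank_one_perturbation Up Um c B p q
  proof
    fix z :: complex assume "cmod z \<noteq> 1"
    then show "poly p z / poly q z = inverse B + cinner (h z c) c"
      using assms(8)[of z]
      by (simp add: \<Phi> caratheodory_fun_def h_def adj C scaleC_one cadjoint_unitary[OF Up])
  qed (fact q pq)+
  define S where "S = {z. poly p z = 0} \<union> {z. poly q z = 0}"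
  \<comment> \<open>If \<open>p\<close> were zero, the origin would be a root off the
    circle.\<close>
  have p: "p \<noteq> 0" using p_root_on_circle[of 0] by auto
  have fin: "finite S" using p q by (simp add: S_def poly_roots_finite)
  have S: "poles_and_zeros \<Phi> = S"
  proof -
    \<comment> \<open>Division by zero gives \<open>0\<close>, so the roots of \<open>q\<close>
      already satisfy \<open>\<Phi> z = 0\<close>.\<close>
    have "\<Phi> z = 0 \<longleftrightarrow> z \<in> S" for z by (simp add: \<Phi> S_def)
    moreover have "z \<in> S" if "is_pole \<Phi> z" for z
      using is_pole_poly_quotient_imp_root[OF that[unfolded \<Phi>]] by (simp add: S_def)
    ultimately show ?thesis unfolding poles_and_zeros_def by blast
  qed
  have S_circle: "S \<subseteq> sphere 0 1"
    using p_root_on_circle q_root_on_circle by (auto simp: S_def)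
  have summable: "summable (\<lambda>l. cmod (fc l))"
  proof -
    \<comment> \<open>Convergence at some \<open>r > 1\<close> forces absolute convergence at
      \<open>1\<close>.\<close>
    obtain r where r: "1 < r" "r < R0" using dense assms(10) by blast
    then have "summable (\<lambda>l. fc l * of_real r ^ l)"
      using assms(12)[of "of_real r"] by (auto simp: summable_def)
    from powser_insidea[OF this, of 1] show ?thesis using r by simp
  qed
  let ?T = "\<lambda>x. power_series_op fc Um x - power_series_op fc Up x"
  have lin_T: "clinear ?T"
    using clinear_power_series_op[OF Up summable] clinear_power_series_op[OF Um summable]
    by (intro clinearI) (simp_all add: clinear_add clinear_scaleC scaleC.diff_right)
  obtain F :: "'a set" where F: "finite F" "is_onb F" using finite_onb_exists by blast
  have f_sums: "(\<lambda>l. fc l * z ^ l) sums f z" if "z \<in> S" for z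
    using assms(10,12) S_circle that by auto
  \<comment> \<open>One series is summed in two ways: through the values of \<open>f\<close> at the
    roots, and through the traces of the powers.\<close>
  have "(\<lambda>l. fc l * ((\<Sum>z\<in>#proots p. z ^ l) - (\<Sum>z\<in>#proots q. z ^ l)))
      sums ((\<Sum>z\<in>#proots p. f z) - (\<Sum>z\<in>#proots q. f z))"
    unfolding right_diff_distrib
    by (intro sums_diff power_sums_sums f_sums) (use p q in \<open>auto simp: S_def\<close>)
  moreover have "(\<lambda>l. fc l * ((\<Sum>z\<in>#proots p. z ^ l) - (\<Sum>z\<in>#proots q. z ^ l)))
      sums op_trace ?T"
    using trace_power_series_diff_sums[OF Up Um summable, of F]
    by (simp add: trace_power_diff_eq_power_sums[OF F] op_trace_finite[OF F lin_T])
  ultimately have "op_trace ?T = (\<Sum>z\<in>#proots p. f z) - (\<Sum>z\<in>#proots q. f z)"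
    by (rule sums_unique2[symmetric])
  also have "\<dots> = (\<Sum>z\<in>S. of_nat (order z p) * f z) - (\<Sum>z\<in>S. of_nat (order z q) * f z)"
    using sum_mset_proots[OF p fin, of f] sum_mset_proots[OF q fin, of f] by (simp add: S_def)
  also have "\<dots> = (\<Sum>z\<in>S. of_int (zorder \<Phi> z) * f z)"
    by (simp add: \<Phi> zorder_poly_quotient[OF p q] left_diff_distrib sum_subtractf)
  finally show ?thesis
    using S S_circle trace_class_finite[OF F lin_T] by simp
qed

end
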